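(* Let $\varepsilon\in(0,1)$, and let $q=q(n)$ be a positive integer depending on $n$. Consider, for each $n$, the rate-$1$ continuous-time Diaconis–Gangolli random walk on $1\times n$ contingency tables over $\mathbb{Z}_q$ (with any fixed coordinate sum), and let $d(t)$ and $t_{\mathrm{mix}}(\varepsilon)$ be as defined in the context. (a) Let $$\alpha:=\inf\Big\{z\ge 1:\ 4\varepsilon^2\ge \exp\Big(\tfrac{4+4e^{2/e}}{\sqrt z}\Big)-1\Big\}.$$ If $q/n\to\infty$ as $n\to\infty$, then for $t=t_n=\dfrac{nq^2\log(\alpha n)}{8\pi^2}\Big(1-\dfrac{1}{3q}\Big)^{-1}$ we have $d(t_n)\le \varepsilon+o(1)$ as $n\to\infty$ (i.e. $\limsup_{n\to\infty} d(t_n)\le\varepsilon$). (b) If $q/\sqrt{\log n}\to\infty$ as $n\to\infty$, then for all sufficiently large $n$, $$t_{\mathrm{mix}}(\varepsilon)\ \ge\ \frac{nq^2}{8\pi^2}\Big(\log n+\log\Big(1-\frac1n\Big)+\log\Big(\frac{\varepsilon^{-1}-1}{5}\Big)\Big).$$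
   Context: $\mathbb{Z}_q=\mathbb{Z}/q\mathbb{Z}$. A $1\times n$ contingency table over $\mathbb{Z}_q$ is a vector $x\in\mathbb{Z}_q^n$ with prescribed coordinate sum $s\in\mathbb{Z}_q$; the state space is $\Omega=\{x\in\mathbb{Z}_q^n:\sum_i x_i=s\}$. The rate-$1$ continuous-time Diaconis–Gangolli walk on $\Omega$ jumps at the times of a rate-$1$ Poisson process; at each jump, an ordered pair $(i,j)$ of distinct coordinates is chosen uniformly at random, a fair coin is flipped, and on heads coordinate $i$ is incremented by $+1$ and coordinate $j$ by $-1$, on tails coordinate $i$ by $-1$ and coordinate $j$ by $+1$. Let $H_t(x,\cdot)$ be the law at time $t$ started from $x$, $\pi$ the uniform distribution on $\Omega$, $\|\mu-\nu\|_{TV}=\max_{A\subset\Omega}|\mu(A)-\nu(A)|$, $d(t)=\max_{x\in\Omega}\|H_t(x,\cdot)-\pi\|_{TV}$, and $t_{\mathrm{mix}}(\varepsilon)=\inf\{t\ge0: d(t)\le\varepsilon\}$. *)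

theory Defs
  imports "HOL-Analysis.Analysis"
begin

definition tables :: "nat \<Rightarrow> nat \<Rightarrow> nat \<Rightarrow> (nat \<Rightarrow> nat) set" where
  "tables n q s = {x. (\<forall>i<n. x i < q) \<and> (\<forall>i. n \<le> i \<longrightarrow> x i = 0)
                      \<and> (\<Sum>i<n. x i) mod q = s mod q}"

definition dg_move :: "nat \<Rightarrow> nat \<Rightarrow> nat \<Rightarrow> (nat \<Rightarrow> nat) \<Rightarrow> (nat \<Rightarrow> nat)" where
  "dg_move q i j x = x(i := (x i + 1) mod q, j := (x j + q - 1) mod q)"

text \<open>One-step transition probability of the Diaconis-Gangolli walk:
  uniform ordered pair (i,j), i \<noteq> j, fair coin for the sign.\<close>
definition dg_kernel :: "nat \<Rightarrow> nat \<Rightarrow> (nat \<Rightarrow> nat) \<Rightarrow> (nat \<Rightarrow> nat) \<Rightarrow> real" where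
  "dg_kernel n q x y =
     (\<Sum>i<n. \<Sum>j<n. if i = j then 0
        else (of_bool (y = dg_move q i j x) + of_bool (y = dg_move q j i x)) / 2)
     / (real n * (real n - 1))"

fun dg_step_pow :: "nat \<Rightarrow> nat \<Rightarrow> nat \<Rightarrow> nat \<Rightarrow> (nat \<Rightarrow> nat) \<Rightarrow> (nat \<Rightarrow> nat) \<Rightarrow> real" where
  "dg_step_pow n q s 0 x y = of_bool (x = y)"
| "dg_step_pow n q s (Suc k) x y =
     (\<Sum>z\<in>tables n q s. dg_step_pow n q s k x z * dg_kernel n q z y)"

definition dg_heat :: "nat \<Rightarrow> nat \<Rightarrow> nat \<Rightarrow> real \<Rightarrow> (nat \<Rightarrow> nat) \<Rightarrow> (nat \<Rightarrow> nat) \<Rightarrow> real" where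
  "dg_heat n q s t x y = (\<Sum>k. exp (- t) * t ^ k / fact k * dg_step_pow n q s k x y)"

definition dg_tv :: "nat \<Rightarrow> nat \<Rightarrow> nat \<Rightarrow> real \<Rightarrow> (nat \<Rightarrow> nat) \<Rightarrow> real" where
  "dg_tv n q s t x = Max ((\<lambda>A. \<bar>(\<Sum>y\<in>A. dg_heat n q s t x y)
                          - real (card A) / real (card (tables n q s))\<bar>) ` Pow (tables n q s))"

definition dg_dist :: "nat \<Rightarrow> nat \<Rightarrow> nat \<Rightarrow> real \<Rightarrow> real" where
  "dg_dist n q s t = Max ((\<lambda>x. dg_tv n q s t x) ` tables n q s)"

definition dg_tmix :: "nat \<Rightarrow> nat \<Rightarrow> nat \<Rightarrow> real \<Rightarrow> real" where
  "dg_tmix n q s \<epsilon> = Inf {t. 0 \<le> t \<and> dg_dist n q s t \<le> \<epsilon>}"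

end

theory Submission
  imports Defs "HOL-Number_Theory.Cong"
begin

text \<open>The characters \<open>x \<mapsto> exp (2\<pi>i b\<cdot>x / q)\<close> of \<open>\<int>\<^sub>q\<^sup>n\<close> are eigenfunctions of the walk; the spectral gap
  of \<open>b\<close> is the average of \<open>1 - cos (2\<pi>(b\<^sub>i - b\<^sub>j) / q)\<close> over the ordered pairs \<open>i \<noteq> j\<close>, and the constant
  frequencies carry the stationary part.

  Upper bound: by Plancherel, \<open>4 d(t)\<^sup>2\<close> is at most the sum of \<open>exp (- 2t gap(b))\<close> over the non-constant
  \<open>b\<close>, divided by \<open>q\<close>. With \<open>X = \<alpha>n\<close>, the frequencies having \<open>k \<le> n/4\<close> coordinates different from a
  dominant value contribute at most \<open>binom(n,k) (3 X\<^sup>-\<^sup>\<rho>)\<^sup>k\<close> with \<open>\<rho> = (n - k)/(n - 1)\<close>, which is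
  at most \<open>(3e \<alpha>\<^sup>-\<^sup>3\<^sup>/\<^sup>4)\<^sup>k\<close> because \<open>n\<^sup>1\<^sup>-\<^sup>\<rho> \<le> k\<close>. For all other \<open>b\<close>, half of the energy is at least of
  order \<open>n log X\<close>, while the other half, estimated by a star around one coordinate, keeps the sum over
  the \<open>q\<^sup>n\<close> frequencies bounded by \<open>q\<close> times an exponential in \<open>n\<close>. Since \<open>\<epsilon> < 1\<close> forces
  \<open>\<surd>\<alpha> \<ge> 6.25\<close>, the total stays below \<open>(4 + 4e\<^sup>2\<^sup>/\<^sup>e) / \<surd>\<alpha>\<close>.

  Lower bound: the second moment method for \<open>\<Phi>(y) = \<Sum>\<^sub>j exp (2\<pi>i y\<^sub>j / q)\<close> started at \<open>(s, 0, \<dots>, 0)\<close>,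
  whose variance never exceeds \<open>n\<close>.\<close>


subsection \<open>Roots of unity and characters\<close>

definition unit_root :: "nat \<Rightarrow> int \<Rightarrow> complex" where
  "unit_root q k = cis (2 * pi * of_int k / real q)"

lemma unit_root_0 [simp]: "unit_root q 0 = 1"
  by (simp add: unit_root_def)

lemma unit_root_add: "unit_root q (k + l) = unit_root q k * unit_root q l"
  by (simp add: unit_root_def cis_mult add_divide_distrib algebra_simps)

lemma norm_unit_root [simp]: "norm (unit_root q k) = 1"
  by (simp add: unit_root_def)

lemma cnj_unit_root: "cnj (unit_root q k) = unit_root q (- k)"
  by (simp add: unit_root_def cis_cnj)

lemma Re_unit_root: "Re (unit_root q k) = cos (2 * pi * of_int k / real q)"
  by (simp add: unit_root_def)

lemma unit_root_eq_1_iff: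
  assumes "0 < q"
  shows "unit_root q k = 1 \<longleftrightarrow> int q dvd k"
proof
  assume "unit_root q k = 1"
  then have "cos (2 * pi * of_int k / real q) = 1"
    by (metis Re_unit_root one_complex.simps(1))
  then obtain m :: int where "2 * pi * of_int k / real q = of_int m * 2 * pi"
    unfolding cos_one_2pi_int by blast
  then have "real_of_int k = of_int (m * int q)"
    using assms by (simp add: field_simps)
  then show "int q dvd k"
    by (metis dvd_triv_right of_int_eq_iff)
next
  assume "int q dvd k"
  then obtain m where "k = int q * m" by auto
  then have "unit_root q k = cis (2 * pi * of_int m)"
    using assms by (simp add: unit_root_def mult.assoc)
  then show "unit_root q k = 1" by (metis Ints_of_int cis_multiple_2pi)
qed

lemma unit_root_cong:
  assumes "0 < q" "[k = l] (mod int q)"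
  shows "unit_root q k = unit_root q l"
proof -
  have "unit_root q (k - l) = 1"
    using assms by (simp add: unit_root_eq_1_iff cong_iff_dvd_diff)
  then show ?thesis
    using unit_root_add[of q "k - l" l] by simp
qed

lemma cos_lt_1_unless_dvd:
  assumes "0 < q" "\<not> int q dvd k"
  shows "cos (2 * pi * of_int k / real q) < 1"
proof -
  have "cos (2 * pi * of_int k / real q) \<noteq> 1"
  proof
    assume *: "cos (2 * pi * of_int k / real q) = 1"
    have "Re (unit_root q k) = 1" using * by (simp add: Re_unit_root)
    moreover have "Im (unit_root q k) = 0"
      using * by (simp add: unit_root_def cos_one_sin_zero)
    ultimately have "unit_root q k = 1" by (simp add: complex_eq_iff)
    with assms show False by (simp add: unit_root_eq_1_iff)
  qed
  then show ?thesis using cos_le_one[of "2 * pi * of_int k / real q"] by linarith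
qed

lemma sum_unit_root:
  assumes "0 < q"
  shows "(\<Sum>m<q. unit_root q (k * int m)) = (if int q dvd k then of_nat q else 0)"
proof (cases "int q dvd k")
  case True
  then have "unit_root q (k * int m) = 1" for m
    using assms by (simp add: unit_root_eq_1_iff)
  then show ?thesis using True by simp
next
  case False
  have pow: "unit_root q (k * int m) = unit_root q k ^ m" for m
    by (induction m) (simp_all add: unit_root_add distrib_left mult.commute)
  have "unit_root q k ^ q = 1"
    using assms by (simp flip: pow add: unit_root_eq_1_iff)
  moreover have "unit_root q k \<noteq> 1"
    using False assms by (simp add: unit_root_eq_1_iff)
  ultimately show ?thesis
    using False by (simp add: pow geometric_sum)
qed

definition chi :: "nat \<Rightarrow> nat \<Rightarrow> (nat \<Rightarrow> int) \<Rightarrow> (nat \<Rightarrow> nat) \<Rightarrow> complex" where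
  "chi n q b x = unit_root q (\<Sum>i<n. b i * int (x i))"

lemma chi_prod: "chi n q b x = (\<Prod>i<n. unit_root q (b i * int (x i)))"
  unfolding chi_def by (induction n) (simp_all add: unit_root_add)

lemma norm_chi [simp]: "norm (chi n q b x) = 1"
  by (simp add: chi_def)


subsection \<open>The discrete cube\<close>

text \<open>\<open>cube n q\<close> plays two parts: the ambient group of the tables and its dual,
  the set of frequencies. Entries beyond \<open>n\<close> are pinned to 0 so that each vector is
  exactly one function.\<close>

definition cube :: "nat \<Rightarrow> nat \<Rightarrow> (nat \<Rightarrow> nat) set" where
  "cube n q = {x. (\<forall>i<n. x i < q) \<and> (\<forall>i. n \<le> i \<longrightarrow> x i = 0)}"

lemma cube_0 [simp]: "cube 0 q = {\<lambda>_. 0}"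
  by (auto simp: cube_def)

lemma cube_Suc_bij:
  "bij_betw (\<lambda>(x, m). x(n := m)) (cube n q \<times> {..<q}) (cube (Suc n) q)"
proof (rule bij_betw_byWitness[where f' = "\<lambda>y. (y(n := 0), y n)"])
  show "\<forall>a\<in>cube n q \<times> {..<q}.
      (\<lambda>y. (y(n := 0), y n)) ((\<lambda>(x, m). x(n := m)) a) = a"
    by (auto simp: cube_def)
qed (auto simp: cube_def less_Suc_eq)

lemma finite_cube [simp]: "finite (cube n q)"
proof (induction n)
  case (Suc n)
  then show ?case using bij_betw_finite[OF cube_Suc_bij[of n q]] by simp
qed simp

lemma sum_cube_Suc:
  "(\<Sum>x\<in>cube (Suc n) q. F x) = (\<Sum>x\<in>cube n q. \<Sum>m<q. F (x(n := m)))"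
  using sum.reindex_bij_betw[OF cube_Suc_bij[of n q], of F]
  by (simp add: sum.cartesian_product case_prod_unfold)

text \<open>Splitting off the last coordinate turns the sum into a product. Orthogonality, the sums
  with fixed support and the star estimate all factor through this.\<close>

lemma sum_prod_cube:
  fixes f :: "nat \<Rightarrow> nat \<Rightarrow> 'a::comm_semiring_1"
  shows "(\<Sum>x\<in>cube n q. \<Prod>i<n. f i (x i)) = (\<Prod>i<n. \<Sum>m<q. f i m)"
proof (induction n)
  case (Suc n)
  have "(\<Sum>x\<in>cube (Suc n) q. \<Prod>i<Suc n. f i (x i))
      = (\<Sum>x\<in>cube n q. \<Sum>m<q. (\<Prod>i<n. f i (x i)) * f n m)"
    unfolding sum_cube_Suc by (intro sum.cong refl) simp
  also have "\<dots> = (\<Sum>x\<in>cube n q. \<Prod>i<n. f i (x i)) * (\<Sum>m<q. f n m)"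
    by (simp add: sum_product)
  finally show ?case by (simp add: Suc)
qed simp

text \<open>The sum runs over frequencies; it factors into one geometric sum per coordinate, which
  vanishes unless \<open>x i = y i\<close>.\<close>

lemma chi_orthogonality:
  assumes "0 < q" "x \<in> cube n q" "y \<in> cube n q"
  shows "(\<Sum>b\<in>cube n q. chi n q (int \<circ> b) x * cnj (chi n q (int \<circ> b) y))
       = (if x = y then of_nat (q ^ n) else 0)"
proof -
  have "(\<Sum>b\<in>cube n q. chi n q (int \<circ> b) x * cnj (chi n q (int \<circ> b) y))
      = (\<Sum>b\<in>cube n q. \<Prod>i<n. unit_root q ((int (x i) - int (y i)) * int (b i)))"
    by (intro sum.cong refl)
      (simp add: chi_prod cnj_unit_root flip: prod.distrib unit_root_add, simp add: algebra_simps)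
  also have "\<dots> = (\<Prod>i<n. \<Sum>m<q. unit_root q ((int (x i) - int (y i)) * int m))"
    by (rule sum_prod_cube[where f = "\<lambda>i m. unit_root q ((int (x i) - int (y i)) * int m)"])
  also have "\<dots> = (\<Prod>i<n. if int q dvd int (x i) - int (y i) then of_nat q else 0)"
    using assms(1) by (simp add: sum_unit_root)
  also have "\<dots> = (\<Prod>i<n. if x i = y i then of_nat q else 0)"
  proof (intro prod.cong refl)
    fix i assume "i \<in> {..<n}"
    then have "x i < q" "y i < q" using assms by (auto simp: cube_def)
    then have "int q dvd int (x i) - int (y i) \<longleftrightarrow> x i = y i"
      by (metis cong_iff_dvd_diff cong_int_iff cong_less_modulus_unique_nat cong_refl)
    then show "(if int q dvd int (x i) - int (y i) then of_nat q else 0)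
        = (if x i = y i then of_nat q else (0::complex))" by simp
  qed
  also have "\<dots> = (if x = y then of_nat (q ^ n) else 0)"
  proof (cases "x = y")
    case False
    then obtain i where "x i \<noteq> y i" by auto
    moreover from this have "i < n"
      using assms by (auto simp: cube_def) (metis not_le_imp_less)
    ultimately show ?thesis using False by (auto intro!: prod_zero)
  qed simp
  finally show ?thesis .
qed

text \<open>Expanding the square gives a double sum over points; after exchanging it with the sum
  over \<open>b\<close>, orthogonality leaves only the diagonal.\<close>

lemma plancherel:
  fixes g :: "(nat \<Rightarrow> nat) \<Rightarrow> complex"
  assumes "0 < q"
  shows "(\<Sum>b\<in>cube n q. (norm (\<Sum>x\<in>cube n q. g x * chi n q (int \<circ> b) x))\<^sup>2)
       = real q ^ n * (\<Sum>x\<in>cube n q. (norm (g x))\<^sup>2)"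
proof -
  let ?c = "\<lambda>b. chi n q (int \<circ> b)"
  have "complex_of_real (\<Sum>b\<in>cube n q. (norm (\<Sum>x\<in>cube n q. g x * ?c b x))\<^sup>2)
     = (\<Sum>b\<in>cube n q. (\<Sum>x\<in>cube n q. g x * ?c b x) * (\<Sum>y\<in>cube n q. cnj (g y) * cnj (?c b y)))"
    unfolding of_real_sum complex_norm_square by simp
  also have "\<dots> = (\<Sum>b\<in>cube n q. \<Sum>x\<in>cube n q. \<Sum>y\<in>cube n q. (g x * cnj (g y)) * (?c b x * cnj (?c b y)))"
    by (simp add: sum_product mult_ac)
  also have "\<dots> = (\<Sum>x\<in>cube n q. \<Sum>b\<in>cube n q. \<Sum>y\<in>cube n q. (g x * cnj (g y)) * (?c b x * cnj (?c b y)))"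
    by (rule sum.swap)
  also have "\<dots> = (\<Sum>x\<in>cube n q. \<Sum>y\<in>cube n q. \<Sum>b\<in>cube n q. (g x * cnj (g y)) * (?c b x * cnj (?c b y)))"
    by (intro sum.cong refl sum.swap)
  also have "\<dots> = (\<Sum>x\<in>cube n q. \<Sum>y\<in>cube n q. if x = y then g x * cnj (g y) * of_nat (q ^ n) else 0)"
    using assms by (intro sum.cong refl) (simp add: chi_orthogonality flip: sum_distrib_left)
  also have "\<dots> = (\<Sum>x\<in>cube n q. g x * cnj (g x) * of_nat (q ^ n))"
    by simp
  also have "\<dots> = complex_of_real (real q ^ n * (\<Sum>x\<in>cube n q. (norm (g x))\<^sup>2))"
    unfolding of_real_mult of_real_sum complex_norm_square by (simp add: sum_distrib_left mult_ac)
  finally show ?thesis using of_real_eq_iff by blast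
qed


subsection \<open>Moves and eigenfunctions\<close>

lemma tables_eq_cube: "tables n q s = {x \<in> cube n q. (\<Sum>i<n. x i) mod q = s mod q}"
  by (auto simp: tables_def cube_def)

lemma finite_tables [simp]: "finite (tables n q s)"
  by (simp add: tables_eq_cube)

lemma tables_subset_cube: "tables n q s \<subseteq> cube n q"
  by (auto simp: tables_eq_cube)

text \<open>Integer congruences hide the \<open>+ q\<close> that protects \<open>dg_move\<close>
  from truncated subtraction.\<close>

lemma dg_move_cong:
  assumes "0 < q" "i \<noteq> j"
  shows "[int (dg_move q i j x k) = int (x k) + of_bool (k = i) - of_bool (k = j)] (mod int q)"
proof -
  have "int ((x j + q - 1) mod q) mod int q = (int (x j) - 1) mod int q"
  proof -
    have "int (x j + q - 1) = (int (x j) - 1) + int q" using assms by auto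
    then show ?thesis by (simp add: zmod_int)
  qed
  moreover have "int ((x i + 1) mod q) mod int q = (int (x i) + 1) mod int q"
    by (simp add: zmod_int add.commute)
  ultimately show ?thesis
    using assms unfolding cong_def dg_move_def by auto
qed

text \<open>One computation for two uses: \<open>b = 1\<close> shows that moves preserve the
  coordinate sum, general \<open>b\<close> shows how they act on characters.\<close>

lemma dg_move_sum_cong:
  assumes "0 < q" "i \<noteq> j" "i < n" "j < n"
  shows "[(\<Sum>k<n. b k * int (dg_move q i j x k)) = (\<Sum>k<n. b k * int (x k)) + (b i - b j)] (mod int q)"
proof -
  have "[(\<Sum>k<n. b k * int (dg_move q i j x k))
      = (\<Sum>k<n. b k * (int (x k) + of_bool (k = i) - of_bool (k = j)))] (mod int q)"
    by (intro cong_sum cong_mult cong_refl dg_move_cong assms)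
  also have "(\<Sum>k<n. b k * (int (x k) + of_bool (k = i) - of_bool (k = j)))
      = (\<Sum>k<n. b k * int (x k) + (if k = i then b k else 0) - (if k = j then b k else 0))"
    by (intro sum.cong refl) (auto simp: algebra_simps)
  also have "\<dots> = (\<Sum>k<n. b k * int (x k)) + (b i - b j)"
    using assms by (simp add: sum.distrib sum_subtractf)
  finally show ?thesis .
qed

lemma dg_move_in_tables:
  assumes "0 < q" "i \<noteq> j" "i < n" "j < n" "x \<in> tables n q s"
  shows "dg_move q i j x \<in> tables n q s"
proof -
  have "dg_move q i j x \<in> cube n q"
    using assms by (auto simp: dg_move_def tables_def cube_def)
  moreover have "[(\<Sum>k<n. int (dg_move q i j x k)) = (\<Sum>k<n. int (x k))] (mod int q)"
    using dg_move_sum_cong[OF assms(1-4), of "\<lambda>_. 1" x] by simp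
  then have "[(\<Sum>k<n. dg_move q i j x k) = (\<Sum>k<n. x k)] (mod q)"
    by (simp flip: cong_int_iff)
  ultimately show ?thesis
    using assms(5) by (simp add: tables_eq_cube cong_def)
qed

lemma chi_dg_move:
  assumes "0 < q" "i \<noteq> j" "i < n" "j < n"
  shows "chi n q b (dg_move q i j x) = chi n q b x * unit_root q (b i - b j)"
  unfolding chi_def unit_root_add[symmetric]
  by (rule unit_root_cong[OF assms(1) dg_move_sum_cong[OF assms]])

lemma dg_move_inverse:
  assumes "0 < q" "i \<noteq> j" "i < n" "j < n" "x \<in> cube n q"
  shows "dg_move q j i (dg_move q i j x) = x"
proof
  fix k
  have lt: "x k < q" if "k = i \<or> k = j" for k using assms that by (auto simp: cube_def)
  have "[int (dg_move q j i (dg_move q i j x) k)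
      = (int (x k) + of_bool (k = i) - of_bool (k = j)) + of_bool (k = j) - of_bool (k = i)] (mod int q)"
    by (rule cong_trans[OF dg_move_cong[OF assms(1) assms(2)[symmetric]]])
      (intro cong_diff cong_add cong_refl dg_move_cong assms)
  then have "[int (dg_move q j i (dg_move q i j x) k) = int (x k)] (mod int q)"
    by simp
  then have "[dg_move q j i (dg_move q i j x) k = x k] (mod q)"
    by (simp add: cong_int_iff)
  moreover have "dg_move q j i (dg_move q i j x) k < q" if "k = i \<or> k = j"
    using assms that by (auto simp: dg_move_def)
  ultimately show "dg_move q j i (dg_move q i j x) k = x k"
    using lt[of k] assms(2) cong_less_modulus_unique_nat
    by (cases "k = i \<or> k = j") (auto simp: dg_move_def)
qed

lemma bij_betw_dg_move:
  assumes "0 < q" "i \<noteq> j" "i < n" "j < n"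
  shows "bij_betw (dg_move q i j) (tables n q s) (tables n q s)"
proof (rule bij_betw_byWitness[where f' = "dg_move q j i"])
  show "\<forall>x\<in>tables n q s. dg_move q j i (dg_move q i j x) = x"
    using dg_move_inverse[OF assms] tables_subset_cube by blast
  show "\<forall>x\<in>tables n q s. dg_move q i j (dg_move q j i x) = x"
    using dg_move_inverse[OF assms(1) assms(2)[symmetric] assms(4,3)] tables_subset_cube by blast
qed (use dg_move_in_tables assms in auto)

text \<open>Reindexing by the move along \<open>i\<close> and \<open>j\<close>, a permutation of the
  state space, multiplies the sum by a root of unity other than 1.\<close>

lemma sum_tables_chi_nonconst:
  assumes "0 < q" "i < n" "j < n" "\<not> [b i = b j] (mod int q)"
  shows "(\<Sum>y\<in>tables n q s. chi n q b y) = 0"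
proof -
  have ij: "i \<noteq> j" using assms(4) by auto
  have "(\<Sum>y\<in>tables n q s. chi n q b y) = (\<Sum>y\<in>tables n q s. chi n q b (dg_move q i j y))"
    by (rule sum.reindex_bij_betw[OF bij_betw_dg_move[OF assms(1) ij assms(2,3)], symmetric])
  also have "\<dots> = (\<Sum>y\<in>tables n q s. chi n q b y) * unit_root q (b i - b j)"
    using chi_dg_move[OF assms(1) ij assms(2,3)] by (simp add: sum_distrib_right)
  finally have "(\<Sum>y\<in>tables n q s. chi n q b y) * (unit_root q (b i - b j) - 1) = 0"
    by (simp add: algebra_simps)
  moreover have "unit_root q (b i - b j) \<noteq> 1"
    using assms by (simp add: unit_root_eq_1_iff cong_iff_dvd_diff)
  ultimately show ?thesis by simp
qed

section \<open>Eigenvalues of the transition kernel\<close>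

text \<open>The diagonal terms are zero, so the average over pairs of distinct coordinates may be
  summed over all pairs.\<close>

definition gap :: "nat \<Rightarrow> nat \<Rightarrow> (nat \<Rightarrow> int) \<Rightarrow> real" where
  "gap n q b = (\<Sum>i<n. \<Sum>j<n. 1 - cos (2 * pi * of_int (b i - b j) / real q))
     / (real n * (real n - 1))"

lemma dg_kernel_nonneg: "0 \<le> dg_kernel n q x y"
proof (cases n)
  case (Suc m)
  then show ?thesis
    unfolding dg_kernel_def by (intro divide_nonneg_nonneg sum_nonneg) auto
qed (simp add: dg_kernel_def)

text \<open>The two orientations of a move multiply the character by conjugate roots of unity, whose
  mean is a cosine; averaging over the pairs gives \<open>1 - gap\<close>.\<close>

lemma dg_kernel_chi:
  assumes "0 < q" "2 \<le> n" "x \<in> tables n q s"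
  shows "(\<Sum>y\<in>tables n q s. complex_of_real (dg_kernel n q x y) * chi n q b y)
       = of_real (1 - gap n q b) * chi n q b x"
proof -
  let ?T = "tables n q s"
  let ?c = "\<lambda>i j. cos (2 * pi * of_int (b i - b j) / real q)"
  let ?D = "complex_of_real (real n * (real n - 1))"
  have single: "(\<Sum>y\<in>?T. of_bool (y = z) * chi n q b y) = chi n q b z" if "z \<in> ?T" for z
    using that by (subst sum.mono_neutral_right[of _ "{z}"]) auto
  have pair: "(\<Sum>y\<in>?T. (of_bool (y = dg_move q i j x) + of_bool (y = dg_move q j i x)) / 2 * chi n q b y)
      = of_real (?c i j) * chi n q b x" if "i \<noteq> j" "i < n" "j < n" for i j
  proof -
    have "(\<Sum>y\<in>?T. (of_bool (y = dg_move q i j x) + of_bool (y = dg_move q j i x)) / 2 * chi n q b y)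
      = (chi n q b (dg_move q i j x) + chi n q b (dg_move q j i x)) / 2"
      using single[of "dg_move q i j x"] single[of "dg_move q j i x"]
        dg_move_in_tables[of q i j n x s] dg_move_in_tables[of q j i n x s] that assms
      by (simp add: ring_distribs sum.distrib flip: sum_divide_distrib)
    also have "\<dots> = chi n q b x * ((unit_root q (b i - b j) + cnj (unit_root q (b i - b j))) / 2)"
      using that assms by (simp add: chi_dg_move cnj_unit_root algebra_simps)
    also have "(unit_root q (b i - b j) + cnj (unit_root q (b i - b j))) / 2 = of_real (?c i j)"
      by (simp add: complex_add_cnj Re_unit_root)
    finally show ?thesis by simp
  qed
  have "(\<Sum>y\<in>?T. complex_of_real (dg_kernel n q x y) * chi n q b y)
     = (\<Sum>y\<in>?T. \<Sum>i<n. \<Sum>j<n. if i = j then 0 else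
          (of_bool (y = dg_move q i j x) + of_bool (y = dg_move q j i x)) / 2 * chi n q b y) / ?D"
    unfolding dg_kernel_def of_real_divide of_real_sum sum_divide_distrib sum_distrib_right
    by (intro sum.cong refl) (auto simp: field_simps of_bool_def)
  also have "\<dots> = (\<Sum>i<n. \<Sum>j<n. \<Sum>y\<in>?T. if i = j then 0 else
          (of_bool (y = dg_move q i j x) + of_bool (y = dg_move q j i x)) / 2 * chi n q b y) / ?D"
    by (subst sum.swap, subst (2) sum.swap) simp
  also have "\<dots> = (\<Sum>i<n. \<Sum>j<n. if i = j then 0 else of_real (?c i j) * chi n q b x) / ?D"
    using pair by (intro arg_cong[of _ _ "\<lambda>u. u / _"] sum.cong refl) simp
  also have "\<dots> = of_real ((\<Sum>i<n. \<Sum>j<n. if i = j then 0 else ?c i j) / (real n * (real n - 1)))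
      * chi n q b x"
    unfolding of_real_divide of_real_sum sum_divide_distrib sum_distrib_right
    by (intro sum.cong refl) auto
  also have "(\<Sum>i<n. \<Sum>j<n. if i = j then 0 else ?c i j) / (real n * (real n - 1)) = 1 - gap n q b"
  proof -
    \<comment> \<open>On the diagonal the cosine is 1, so \<open>1 - 1 - (1 - 1)\<close> reproduces
      the excluded value 0.\<close>
    have "(\<Sum>i<n. \<Sum>j<n. if i = j then 0 else ?c i j)
        = (\<Sum>i<n. \<Sum>j<n. 1 - of_bool (i = j) - (1 - ?c i j))"
      by (intro sum.cong refl) auto
    also have "\<dots> = real n * (real n - 1) - (\<Sum>i<n. \<Sum>j<n. 1 - ?c i j)"
      by (simp add: sum_subtractf algebra_simps)
    finally show ?thesis
      using assms by (simp add: gap_def diff_divide_distrib)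
  qed
  finally show ?thesis .
qed


subsection \<open>Spectral analysis of the heat kernel\<close>

lemma gap_const:
  assumes "0 < q" "\<And>i j. i < n \<Longrightarrow> j < n \<Longrightarrow> [b i = b j] (mod int q)"
  shows "gap n q b = 0"
proof -
  have "cos (2 * pi * of_int (b i - b j) / real q) = 1" if "i < n" "j < n" for i j
    unfolding Re_unit_root[symmetric]
    using assms that by (metis cong_iff_dvd_diff one_complex.simps(1) unit_root_eq_1_iff)
  then show ?thesis by (simp add: gap_def)
qed

lemma gap_pos:
  assumes "0 < q" "i < n" "j < n" "\<not> [b i = b j] (mod int q)"
  shows "0 < gap n q b"
proof -
  let ?g = "\<lambda>i j. 1 - cos (2 * pi * of_int (b i - b j) / real q)"
  have "i \<noteq> j" using assms(4) by auto
  then have "2 \<le> n" using assms by linarith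
  have "0 < ?g i j"
    using cos_lt_1_unless_dvd[OF assms(1), of "b i - b j"] assms(4) by (simp add: cong_iff_dvd_diff)
  also have "\<dots> \<le> (\<Sum>j<n. ?g i j)"
    using assms by (intro member_le_sum) auto
  also have "\<dots> \<le> (\<Sum>i<n. \<Sum>j<n. ?g i j)"
    using assms by (intro member_le_sum[where f = "\<lambda>i. \<Sum>j<n. ?g i j"]) (auto intro!: sum_nonneg)
  finally show ?thesis
    using \<open>2 \<le> n\<close> by (auto simp: gap_def intro!: divide_pos_pos)
qed

lemma dg_step_pow_nonneg: "0 \<le> dg_step_pow n q s k x y"
  by (induction k arbitrary: y) (auto intro!: sum_nonneg mult_nonneg_nonneg dg_kernel_nonneg)

lemma dg_step_pow_chi:
  assumes "0 < q" "2 \<le> n" "x \<in> tables n q s"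
  shows "(\<Sum>y\<in>tables n q s. complex_of_real (dg_step_pow n q s k x y) * chi n q b y)
       = of_real ((1 - gap n q b) ^ k) * chi n q b x"
proof (induction k)
  case 0
  have "(\<Sum>y\<in>tables n q s. complex_of_real (dg_step_pow n q s 0 x y) * chi n q b y)
      = (\<Sum>y\<in>tables n q s. if x = y then chi n q b y else 0)"
    by (intro sum.cong refl) auto
  then show ?case using assms by simp
next
  case (Suc k)
  let ?T = "tables n q s" and ?P = "\<lambda>z. complex_of_real (dg_step_pow n q s k x z)"
  have "(\<Sum>y\<in>?T. complex_of_real (dg_step_pow n q s (Suc k) x y) * chi n q b y)
     = (\<Sum>y\<in>?T. \<Sum>z\<in>?T. ?P z * (complex_of_real (dg_kernel n q z y) * chi n q b y))"
    by (simp add: sum_distrib_right mult.assoc)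
  also have "\<dots> = (\<Sum>z\<in>?T. ?P z * (\<Sum>y\<in>?T. complex_of_real (dg_kernel n q z y) * chi n q b y))"
    by (subst sum.swap) (simp add: sum_distrib_left)
  also have "\<dots> = (\<Sum>z\<in>?T. ?P z * (of_real (1 - gap n q b) * chi n q b z))"
    using assms by (intro sum.cong refl) (simp add: dg_kernel_chi)
  also have "\<dots> = of_real (1 - gap n q b) * (\<Sum>z\<in>?T. ?P z * chi n q b z)"
    by (simp add: sum_distrib_left mult_ac)
  finally show ?case by (simp only: Suc power_Suc of_real_mult mult.assoc)
qed

lemma chi_zero [simp]: "chi n q (\<lambda>_. 0) x = 1"
  by (simp add: chi_def)

text \<open>This is the zero frequency, whose character is 1 and whose gap is 0.\<close>

lemma dg_step_pow_sum:
  assumes "0 < q" "2 \<le> n" "x \<in> tables n q s"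
  shows "(\<Sum>y\<in>tables n q s. dg_step_pow n q s k x y) = 1"
proof -
  have "complex_of_real (\<Sum>y\<in>tables n q s. dg_step_pow n q s k x y) = 1"
    using dg_step_pow_chi[OF assms, of k "\<lambda>_. 0"] gap_const[OF assms(1), of n "\<lambda>_. 0"] by simp
  then show ?thesis by (metis of_real_eq_1_iff)
qed

lemma dg_step_pow_le_1:
  assumes "0 < q" "2 \<le> n" "x \<in> tables n q s" "y \<in> tables n q s"
  shows "dg_step_pow n q s k x y \<le> 1"
  using member_le_sum[of y "tables n q s" "dg_step_pow n q s k x"] assms
  by (simp add: dg_step_pow_nonneg dg_step_pow_sum)

text \<open>The Poisson generating function; at \<open>a = 1 - gap\<close> it yields the decay
  \<open>exp (- t * gap)\<close>.\<close>

lemma exp_weights_sums: "(\<lambda>k. exp (- t) * t ^ k / fact k * a ^ k) sums exp (- (t * (1 - a)))"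
  for t a :: real
proof -
  have "(\<lambda>k. exp (- t) * ((t * a) ^ k /\<^sub>R fact k)) sums (exp (- t) * exp (t * a))"
    by (intro sums_mult exp_converges)
  moreover have "exp (- t) * exp (t * a) = exp (- (t * (1 - a)))"
    by (simp add: mult_exp_exp algebra_simps)
  moreover have "(\<lambda>k. exp (- t) * ((t * a) ^ k /\<^sub>R fact k))
      = (\<lambda>k. exp (- t) * t ^ k / fact k * a ^ k)"
    by (simp add: power_mult_distrib field_simps)
  ultimately show ?thesis by simp
qed

lemma dg_heat_sums:
  assumes "0 < q" "2 \<le> n" "x \<in> tables n q s" "y \<in> tables n q s" "0 \<le> t"
  shows "(\<lambda>k. exp (- t) * t ^ k / fact k * dg_step_pow n q s k x y) sums dg_heat n q s t x y"
  unfolding dg_heat_def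
proof (rule summable_sums, rule summable_comparison_test')
  show "summable (\<lambda>k. exp (- t) * t ^ k / fact k)"
    using exp_weights_sums[of t 1] by (simp add: sums_iff)
  fix k :: nat
  show "norm (exp (- t) * t ^ k / fact k * dg_step_pow n q s k x y) \<le> exp (- t) * t ^ k / fact k"
    using assms dg_step_pow_nonneg[of n q s k x y]
      mult_left_le[OF dg_step_pow_le_1[OF assms(1-4), of k], of "exp (- t) * t ^ k / fact k"]
    by (simp add: abs_mult)
qed

lemma dg_heat_nonneg: "0 \<le> dg_heat n q s t x y"
  if "0 < q" "2 \<le> n" "x \<in> tables n q s" "y \<in> tables n q s" "0 \<le> t"
  by (rule sums_le[OF _ sums_zero dg_heat_sums[OF that]])
    (use that in \<open>auto intro!: mult_nonneg_nonneg divide_nonneg_nonneg dg_step_pow_nonneg\<close>)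

lemma dg_heat_chi:
  assumes "0 < q" "2 \<le> n" "x \<in> tables n q s" "0 \<le> t"
  shows "(\<Sum>y\<in>tables n q s. complex_of_real (dg_heat n q s t x y) * chi n q b y)
       = of_real (exp (- (t * gap n q b))) * chi n q b x"
proof -
  let ?w = "\<lambda>k. exp (- t) * t ^ k / fact k"
  have "(\<lambda>k. \<Sum>y\<in>tables n q s. complex_of_real (?w k * dg_step_pow n q s k x y) * chi n q b y)
      sums (\<Sum>y\<in>tables n q s. complex_of_real (dg_heat n q s t x y) * chi n q b y)"
    using assms by (intro sums_sum sums_mult2 sums_of_real dg_heat_sums)
  moreover have "(\<Sum>y\<in>tables n q s. complex_of_real (?w k * dg_step_pow n q s k x y) * chi n q b y)
      = of_real (?w k * (1 - gap n q b) ^ k) * chi n q b x" for k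
    using arg_cong[OF dg_step_pow_chi[OF assms(1-3), of k b], of "(*) (complex_of_real (?w k))"]
    by (simp add: sum_distrib_left mult.assoc)
  ultimately have "(\<lambda>k. of_real (?w k * (1 - gap n q b) ^ k) * chi n q b x)
      sums (\<Sum>y\<in>tables n q s. complex_of_real (dg_heat n q s t x y) * chi n q b y)" by simp
  moreover have "(\<lambda>k. of_real (?w k * (1 - gap n q b) ^ k) * chi n q b x)
      sums (of_real (exp (- (t * (1 - (1 - gap n q b))))) * chi n q b x)"
    by (intro sums_mult2 sums_of_real exp_weights_sums)
  ultimately show ?thesis by (simp add: sums_unique2)
qed

lemma dg_heat_sum:
  assumes "0 < q" "2 \<le> n" "x \<in> tables n q s" "0 \<le> t"
  shows "(\<Sum>y\<in>tables n q s. dg_heat n q s t x y) = 1"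
proof -
  have "complex_of_real (\<Sum>y\<in>tables n q s. dg_heat n q s t x y) = 1"
    using dg_heat_chi[OF assms, of "\<lambda>_. 0"] gap_const[OF assms(1), of n "\<lambda>_. 0"] by simp
  then show ?thesis by (metis of_real_eq_1_iff)
qed

section \<open>Constant frequencies and the size of the state space\<close>

definition nonconst :: "nat \<Rightarrow> nat \<Rightarrow> (nat \<Rightarrow> nat) set" where
  "nonconst n q = {b \<in> cube n q. \<exists>i<n. \<exists>j<n. b i \<noteq> b j}"

lemma nonconst_subset: "nonconst n q \<subseteq> cube n q"
  by (auto simp: nonconst_def)

lemma finite_nonconst [simp]: "finite (nonconst n q)"
  using nonconst_subset finite_cube by (rule finite_subset)

lemma nonconst_not_cong:
  assumes "b \<in> nonconst n q"
  obtains i j where "i < n" "j < n" "\<not> [(int \<circ> b) i = (int \<circ> b) j] (mod int q)"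
  using assms by (auto simp: nonconst_def cube_def cong_int_iff cong_def)

lemma sum_tables_nonconst:
  assumes "0 < q" "b \<in> nonconst n q"
  shows "(\<Sum>y\<in>tables n q s. chi n q (int \<circ> b) y) = 0"
  using nonconst_not_cong[OF assms(2)] sum_tables_chi_nonconst[OF assms(1)] by metis

lemma const_eq:
  assumes "b \<in> cube n q - nonconst n q" "i < n" "j < n"
  shows "b i = b j"
  using assms unfolding nonconst_def by blast

lemma card_const:
  assumes "0 < n"
  shows "card (cube n q - nonconst n q) = q"
proof -
  have "cube n q - nonconst n q = (\<lambda>c i. if i < n then c else 0) ` {..<q}" (is "?L = ?R")
  proof
    show "?L \<subseteq> ?R"
    proof
      fix b assume b: "b \<in> ?L"
      have "b = (\<lambda>i. if i < n then b 0 else 0)"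
      proof
        fix i
        show "b i = (if i < n then b 0 else 0)"
          using const_eq[OF b, of i 0] b assms by (cases "i < n") (auto simp: cube_def)
      qed
      moreover have "b 0 < q" using b assms by (auto simp: cube_def)
      ultimately show "b \<in> ?R" by blast
    qed
  qed (auto simp: nonconst_def cube_def)
  moreover have "inj_on (\<lambda>(c::nat) i. if i < n then c else 0) {..<q}"
    using assms by (auto simp: inj_on_def fun_eq_iff)
  ultimately show ?thesis by (simp add: card_image)
qed

text \<open>For constant \<open>b\<close> the exponent is \<open>b 0\<close> times the coordinate
  sum, which modulo \<open>q\<close> is the same for all tables.\<close>

lemma chi_const_tables:
  assumes "0 < n" "b \<in> cube n q - nonconst n q" "x \<in> tables n q s" "y \<in> tables n q s"
  shows "chi n q (int \<circ> b) x = chi n q (int \<circ> b) y"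
proof -
  have b: "b i = b 0" if "i < n" for i using const_eq[OF assms(2) that assms(1)] .
  have "0 < q" using assms by (auto simp: cube_def)
  have sum: "(\<Sum>i<n. (int \<circ> b) i * int (x i)) = int (b 0) * int (\<Sum>i<n. x i)" for x
    unfolding of_nat_sum sum_distrib_left by (intro sum.cong refl) (metis b lessThan_iff o_apply)
  have "[int (\<Sum>i<n. x i) = int (\<Sum>i<n. y i)] (mod int q)"
    using assms unfolding cong_int_iff by (simp add: tables_def cong_def)
  then show ?thesis
    unfolding chi_def sum by (intro unit_root_cong \<open>0 < q\<close> cong_mult cong_refl)
qed

lemma tables_nonempty:
  assumes "0 < n" "0 < q"
  shows "(\<lambda>i. if i = 0 then s mod q else 0) \<in> tables n q s"
  using assms by (auto simp: tables_def)

lemma sum_cube_tables: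
  fixes g :: "(nat \<Rightarrow> nat) \<Rightarrow> 'a::semiring_1"
  shows "(\<Sum>y\<in>cube n q. of_bool (y \<in> tables n q s) * g y) = (\<Sum>y\<in>tables n q s. g y)"
  by (rule sum.mono_neutral_cong_right) (use tables_subset_cube in auto)

lemma plancherel_tables:
  fixes g :: "(nat \<Rightarrow> nat) \<Rightarrow> complex"
  assumes "0 < q"
  shows "(\<Sum>b\<in>cube n q. (norm (\<Sum>y\<in>tables n q s. g y * chi n q (int \<circ> b) y))\<^sup>2)
       = real q ^ n * (\<Sum>y\<in>tables n q s. (norm (g y))\<^sup>2)"
proof -
  have "(\<Sum>b\<in>cube n q. (norm (\<Sum>y\<in>cube n q. (of_bool (y \<in> tables n q s) * g y) * chi n q (int \<circ> b) y))\<^sup>2)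
      = real q ^ n * (\<Sum>y\<in>cube n q. (norm (of_bool (y \<in> tables n q s) * g y))\<^sup>2)"
    by (rule plancherel[OF assms])
  moreover have "(\<Sum>y\<in>cube n q. (of_bool (y \<in> tables n q s) * g y) * chi n q (int \<circ> b) y)
      = (\<Sum>y\<in>tables n q s. g y * chi n q (int \<circ> b) y)" for b
    by (simp add: mult.assoc sum_cube_tables)
  moreover have "(\<Sum>y\<in>cube n q. (norm (of_bool (y \<in> tables n q s) * g y))\<^sup>2)
      = (\<Sum>y\<in>tables n q s. (norm (g y))\<^sup>2)"
    by (rule sum.mono_neutral_cong_right) (use tables_subset_cube in auto)
  ultimately show ?thesis by simp
qed

text \<open>Plancherel for the indicator function of the state space reads \<open>q * N\<^sup>2 = q ^ n * N\<close>.\<close>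
lemma card_tables:
  assumes "0 < n" "0 < q"
  shows "real q * card (tables n q s) = real q ^ n"
proof -
  let ?T = "tables n q s"
  let ?S = "\<lambda>b. \<Sum>y\<in>?T. chi n q (int \<circ> b) y"
  obtain x where x: "x \<in> ?T" using tables_nonempty[OF assms] by blast
  have "real q ^ n * card ?T = (\<Sum>b\<in>cube n q. (norm (?S b))\<^sup>2)"
    using plancherel_tables[OF assms(2), where g = "\<lambda>_. 1" and n = n and s = s] by simp
  also have "\<dots> = (\<Sum>b\<in>cube n q - nonconst n q. (norm (?S b))\<^sup>2)"
  proof (rule sum.mono_neutral_right)
    show "\<forall>b\<in>cube n q - (cube n q - nonconst n q). (norm (?S b))\<^sup>2 = 0"
      using sum_tables_nonconst[OF assms(2)] by auto
  qed auto
  also have "\<dots> = (\<Sum>b\<in>cube n q - nonconst n q. (real (card ?T))\<^sup>2)"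
  proof (intro sum.cong refl)
    fix b assume b: "b \<in> cube n q - nonconst n q"
    have "?S b = (\<Sum>y\<in>?T. chi n q (int \<circ> b) x)"
      by (intro sum.cong refl chi_const_tables[OF assms(1) b _ x])
    then show "(norm (?S b))\<^sup>2 = (real (card ?T))\<^sup>2" by (simp add: norm_mult)
  qed
  also have "\<dots> = real q * (real (card ?T))\<^sup>2"
    using assms by (simp add: card_const)
  finally have "real q ^ n * card ?T = real q * (real (card ?T))\<^sup>2" .
  moreover have "real (card ?T) \<noteq> 0" using x by auto
  ultimately show ?thesis unfolding power2_eq_square mult.assoc[symmetric] by (metis mult_right_cancel)
qed

section \<open>The heat trace and total variation\<close>

text \<open>The division by \<open>q\<close> reflects that adding a constant vector to
  \<open>b\<close> modulo \<open>q\<close> changes its character on the state space only by a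
  constant factor, so each eigenfunction is counted \<open>q\<close> times.\<close>

definition heat_trace :: "nat \<Rightarrow> nat \<Rightarrow> real \<Rightarrow> real" where
  "heat_trace n q t = (\<Sum>b\<in>nonconst n q. exp (- (2 * t * gap n q (int \<circ> b)))) / real q"

text \<open>Plancherel for the deviation from uniformity. Its transform vanishes at constant
  frequencies and is elsewhere \<open>exp (- t * gap)\<close> times a unimodular number, so the
  value does not depend on \<open>x\<close>.\<close>

lemma dg_heat_l2:
  assumes "0 < q" "2 \<le> n" "x \<in> tables n q s" "0 \<le> t"
  shows "card (tables n q s) *
      (\<Sum>y\<in>tables n q s. (dg_heat n q s t x y - 1 / card (tables n q s))\<^sup>2) = heat_trace n q t"
proof -
  let ?T = "tables n q s"
  let ?N = "real (card ?T)"
  let ?g = "\<lambda>y. complex_of_real (dg_heat n q s t x y - 1 / ?N)"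
  let ?S = "\<lambda>b. \<Sum>y\<in>?T. ?g y * chi n q (int \<circ> b) y"
  have N: "?N > 0" using assms by (auto simp: card_gt_0_iff)
  have S: "?S b = of_real (exp (- (t * gap n q (int \<circ> b)))) * chi n q (int \<circ> b) x
      - (\<Sum>y\<in>?T. chi n q (int \<circ> b) y) / of_real ?N" for b
    using dg_heat_chi[OF assms, of "int \<circ> b"]
    by (simp add: left_diff_distrib sum_subtractf sum_divide_distrib)
  have "real q ^ n * (\<Sum>y\<in>?T. (dg_heat n q s t x y - 1 / ?N)\<^sup>2) = (\<Sum>b\<in>cube n q. (norm (?S b))\<^sup>2)"
    unfolding plancherel_tables[OF assms(1)] norm_of_real by simp
  also have "\<dots> = (\<Sum>b\<in>nonconst n q. (norm (?S b))\<^sup>2)"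
  proof (rule sum.mono_neutral_right)
    show "\<forall>b\<in>cube n q - nonconst n q. (norm (?S b))\<^sup>2 = 0"
    proof
      fix b assume b: "b \<in> cube n q - nonconst n q"
      have "(\<Sum>y\<in>?T. chi n q (int \<circ> b) y) = (\<Sum>y\<in>?T. chi n q (int \<circ> b) x)"
        by (rule sum.cong[OF refl chi_const_tables[OF _ b _ assms(3)]]) (use assms in auto)
      moreover have "gap n q (int \<circ> b) = 0"
        using assms const_eq[OF b] by (intro gap_const) (metis cong_refl o_apply)+
      ultimately have "?S b = 0" using assms(3) unfolding S by auto
      then show "(norm (?S b))\<^sup>2 = 0" by simp
    qed
  qed (use nonconst_subset in auto)
  also have "\<dots> = (\<Sum>b\<in>nonconst n q. exp (- (2 * t * gap n q (int \<circ> b))))"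
  proof (intro sum.cong refl)
    fix b assume b: "b \<in> nonconst n q"
    have "(\<Sum>y\<in>?T. chi n q (int \<circ> b) y) = 0"
      by (rule sum_tables_nonconst[OF assms(1) b])
    then have "?S b = of_real (exp (- (t * gap n q (int \<circ> b)))) * chi n q (int \<circ> b) x"
      unfolding S by simp
    then show "(norm (?S b))\<^sup>2 = exp (- (2 * t * gap n q (int \<circ> b)))"
      by (simp add: norm_mult exp_double[symmetric])
  qed
  \<comment> \<open>By \<open>card_tables\<close>, \<open>q ^ n\<close> becomes
    \<open>q * N\<close>, which leaves one factor \<open>q\<close> to divide by.\<close>
  finally have "real q * (?N * (\<Sum>y\<in>?T. (dg_heat n q s t x y - 1 / ?N)\<^sup>2))
      = (\<Sum>b\<in>nonconst n q. exp (- (2 * t * gap n q (int \<circ> b))))"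
    using card_tables[of n q s] assms by (simp only: mult.assoc[symmetric])
  then show ?thesis
    using assms(1) unfolding heat_trace_def by (simp add: field_simps)
qed

text \<open>The deviations sum to zero, so a set and its complement deviate equally; twice that is
  at most the L1 norm, which Cauchy-Schwarz bounds by the L2 norm.\<close>

lemma dg_tv_l2:
  assumes "0 < q" "2 \<le> n" "x \<in> tables n q s" "0 \<le> t"
  shows "2 * dg_tv n q s t x \<le> sqrt (heat_trace n q t)"
proof -
  let ?T = "tables n q s"
  let ?N = "real (card ?T)"
  let ?d = "\<lambda>y. dg_heat n q s t x y - 1 / ?N"
  have N: "?N > 0" using assms by (auto simp: card_gt_0_iff)
  have zero: "(\<Sum>y\<in>?T. ?d y) = 0"
    using N dg_heat_sum[OF assms] assms(3) by (auto simp: sum_subtractf)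
  have "(\<Sum>y\<in>?T. \<bar>?d y\<bar>)\<^sup>2 \<le> ?N * (\<Sum>y\<in>?T. (?d y)\<^sup>2)"
    using Cauchy_Schwarz_ineq_sum[of "\<lambda>_. 1" "\<lambda>y. \<bar>?d y\<bar>" ?T] by simp
  then have l1: "(\<Sum>y\<in>?T. \<bar>?d y\<bar>) \<le> sqrt (heat_trace n q t)"
    unfolding dg_heat_l2[OF assms] by (rule real_le_rsqrt)
  have "2 * \<bar>(\<Sum>y\<in>A. dg_heat n q s t x y) - real (card A) / ?N\<bar> \<le> sqrt (heat_trace n q t)"
    if A: "A \<subseteq> ?T" for A
  proof -
    have fin: "finite A" using A finite_tables by (rule finite_subset)
    have split: "(\<Sum>y\<in>?T. g y) = (\<Sum>y\<in>A. g y) + (\<Sum>y\<in>?T - A. g y)" for g :: "_ \<Rightarrow> real"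
      using A by (metis finite_tables sum.subset_diff add.commute)
    have "2 * \<bar>(\<Sum>y\<in>A. dg_heat n q s t x y) - real (card A) / ?N\<bar> = 2 * \<bar>\<Sum>y\<in>A. ?d y\<bar>"
      by (simp add: sum_subtractf)
    also have "2 * \<bar>\<Sum>y\<in>A. ?d y\<bar> = \<bar>\<Sum>y\<in>A. ?d y\<bar> + \<bar>\<Sum>y\<in>?T - A. ?d y\<bar>"
      using zero split[of ?d] by linarith
    also have "\<dots> \<le> (\<Sum>y\<in>?T. \<bar>?d y\<bar>)"
      unfolding split[of "\<lambda>y. \<bar>?d y\<bar>"] by (intro add_mono sum_abs)
    finally show ?thesis using l1 by (rule order_trans)
  qed
  moreover have "dg_tv n q s t x \<in> (\<lambda>A. \<bar>(\<Sum>y\<in>A. dg_heat n q s t x y) - real (card A) / ?N\<bar>) ` Pow ?T"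
    unfolding dg_tv_def by (rule Max_in) auto
  ultimately show ?thesis by auto
qed

text \<open>The set where the heat kernel is at least the uniform weight carries half of the L1
  norm. This direction serves the lower bound.\<close>

lemma dg_tv_ge_l1:
  assumes "0 < q" "2 \<le> n" "x \<in> tables n q s" "0 \<le> t"
  shows "(\<Sum>y\<in>tables n q s. \<bar>dg_heat n q s t x y - 1 / card (tables n q s)\<bar>) \<le> 2 * dg_tv n q s t x"
proof -
  let ?T = "tables n q s"
  let ?N = "real (card ?T)"
  let ?d = "\<lambda>y. dg_heat n q s t x y - 1 / ?N"
  have N: "?N > 0" using assms by (auto simp: card_gt_0_iff)
  have zero: "(\<Sum>y\<in>?T. ?d y) = 0"
    using N dg_heat_sum[OF assms] assms(3) by (auto simp: sum_subtractf)
  define A where "A = {y \<in> ?T. 0 \<le> ?d y}"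
  have split: "(\<Sum>y\<in>?T. g y) = (\<Sum>y\<in>A. g y) + (\<Sum>y\<in>?T - A. g y)" for g :: "_ \<Rightarrow> real"
    by (subst sum.subset_diff[of A ?T]) (auto simp: A_def)
  have "(\<Sum>y\<in>A. \<bar>?d y\<bar>) = (\<Sum>y\<in>A. ?d y)"
    by (intro sum.cong) (auto simp: A_def)
  moreover have "(\<Sum>y\<in>?T - A. \<bar>?d y\<bar>) = - (\<Sum>y\<in>?T - A. ?d y)"
    unfolding sum_negf[symmetric] by (intro sum.cong) (auto simp: A_def)
  ultimately have "(\<Sum>y\<in>?T. \<bar>?d y\<bar>) = (\<Sum>y\<in>A. ?d y) - (\<Sum>y\<in>?T - A. ?d y)"
    unfolding split[of "\<lambda>y. \<bar>?d y\<bar>"] by linarith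
  also have "\<dots> = 2 * (\<Sum>y\<in>A. ?d y)" using zero split[of ?d] by linarith
  also have "(\<Sum>y\<in>A. ?d y) = (\<Sum>y\<in>A. dg_heat n q s t x y) - real (card A) / ?N"
    by (simp add: sum_subtractf)
  also have "\<dots> \<le> \<bar>(\<Sum>y\<in>A. dg_heat n q s t x y) - real (card A) / ?N\<bar>" by simp
  also have "\<dots> \<le> dg_tv n q s t x"
    unfolding dg_tv_def by (rule Max_ge) (auto simp: A_def)
  finally show ?thesis by simp
qed

lemma dg_dist_l2:
  assumes "0 < q" "2 \<le> n" "0 \<le> t"
  shows "2 * dg_dist n q s t \<le> sqrt (heat_trace n q t)"
proof -
  have "dg_dist n q s t \<in> (\<lambda>x. dg_tv n q s t x) ` tables n q s"
    unfolding dg_dist_def using tables_nonempty[of n q s] assms by (intro Max_in) auto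
  then show ?thesis using dg_tv_l2[OF assms(1,2) _ assms(3)] by auto
qed

lemma dg_tv_le_dist:
  assumes "x \<in> tables n q s"
  shows "dg_tv n q s t x \<le> dg_dist n q s t"
  unfolding dg_dist_def using assms by (intro Max_ge) auto

text \<open>A finite sum of decaying exponentials. It makes the set defining \<open>dg_tmix\<close>
  nonempty, so that its infimum is meaningful.\<close>

lemma heat_trace_tendsto_0: "(heat_trace n q \<longlongrightarrow> 0) at_top" if "0 < q"
proof -
  have "((\<lambda>t. exp (- (2 * t * gap n q (int \<circ> b)))) \<longlongrightarrow> 0) at_top" if b: "b \<in> nonconst n q" for b
  proof -
    have "0 < gap n q (int \<circ> b)"
      using b \<open>0 < q\<close> by (auto elim!: nonconst_not_cong simp del: o_apply intro: gap_pos)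
    then have "filterlim (\<lambda>t. (2 * gap n q (int \<circ> b)) * t) at_top at_top"
      by (intro filterlim_tendsto_pos_mult_at_top[OF tendsto_const] filterlim_ident) auto
    then have "((\<lambda>t. exp (- ((2 * gap n q (int \<circ> b)) * t))) \<longlongrightarrow> 0) at_top"
      by (intro filterlim_compose[OF exp_at_bot] filterlim_compose[OF filterlim_uminus_at_bot_at_top])
    then show ?thesis by (simp add: mult_ac)
  qed
  then have "((\<lambda>t. (\<Sum>b\<in>nonconst n q. exp (- (2 * t * gap n q (int \<circ> b)))) / real q)
      \<longlongrightarrow> (\<Sum>b\<in>nonconst n q. 0) / real q) at_top"
    using that by (intro tendsto_intros) auto
  then show ?thesis by (simp add: heat_trace_def[abs_def])
qed


subsection \<open>The lower bound\<close>

text \<open>Centring \<open>\<Phi>\<close> halfway between its two means, Cauchy--Schwarz is applied to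
  \<open>\<bar>\<mu> - \<nu>\<bar> \<le> sqrt (\<mu> + \<nu>) * sqrt \<bar>\<mu> - \<nu>\<bar>\<close>.\<close>
lemma l1_distance_ge_second_moment:
  fixes \<Phi> :: "'a \<Rightarrow> complex" and \<mu> \<nu> :: "'a \<Rightarrow> real"
  assumes nonneg: "\<And>y. y \<in> T \<Longrightarrow> 0 \<le> \<mu> y" "\<And>y. y \<in> T \<Longrightarrow> 0 \<le> \<nu> y"
    and mass: "sum \<mu> T = 1" "sum \<nu> T = 1"
    and m: "(\<Sum>y\<in>T. of_real (\<mu> y) * \<Phi> y) = m" "(\<Sum>y\<in>T. of_real (\<nu> y) * \<Phi> y) = 0"
    and v: "(\<Sum>y\<in>T. \<mu> y * (norm (\<Phi> y))\<^sup>2) \<le> v + (norm m)\<^sup>2" "(\<Sum>y\<in>T. \<nu> y * (norm (\<Phi> y))\<^sup>2) \<le> v"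
  shows "(norm m)\<^sup>2 \<le> (2 * v + (norm m)\<^sup>2 / 2) * (\<Sum>y\<in>T. \<bar>\<mu> y - \<nu> y\<bar>)"
proof -
  define f where "f y = \<Phi> y - m / 2" for y
  have shift: "(\<Sum>y\<in>T. w y * (norm (f y))\<^sup>2)
      = (\<Sum>y\<in>T. w y * (norm (\<Phi> y))\<^sup>2) - Re ((\<Sum>y\<in>T. of_real (w y) * \<Phi> y) * cnj m) + (norm m)\<^sup>2 / 4"
    if "sum w T = 1" for w :: "'a \<Rightarrow> real"
  proof -
    have "w y * (norm (f y))\<^sup>2
        = w y * (norm (\<Phi> y))\<^sup>2 - Re (of_real (w y) * \<Phi> y * cnj m) + w y * ((norm m)\<^sup>2 / 4)" for y
      unfolding f_def cmod_power2 by (simp add: power2_eq_square field_simps)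
    then have "(\<Sum>y\<in>T. w y * (norm (f y))\<^sup>2)
        = (\<Sum>y\<in>T. w y * (norm (\<Phi> y))\<^sup>2 - Re (of_real (w y) * \<Phi> y * cnj m) + w y * ((norm m)\<^sup>2 / 4))"
      by simp
    also have "\<dots> = (\<Sum>y\<in>T. w y * (norm (\<Phi> y))\<^sup>2) - Re (\<Sum>y\<in>T. of_real (w y) * \<Phi> y * cnj m)
        + sum w T * ((norm m)\<^sup>2 / 4)"
      by (simp only: sum.distrib sum_subtractf Re_sum sum_distrib_right)
      finally show ?thesis using that by (simp add: sum_distrib_right)
  qed
  \<comment> \<open>The cross term is the full \<open>(norm m)\<^sup>2\<close>; it cancels the one
    in the hypothesis and leaves a quarter.\<close>
  have f\<mu>: "(\<Sum>y\<in>T. \<mu> y * (norm (f y))\<^sup>2) \<le> v + (norm m)\<^sup>2 / 4"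
    using v(1) unfolding shift[OF mass(1)] m(1) complex_norm_square[symmetric]
    by (simp add: complex_mult_cnj cmod_power2 power2_eq_square)
  have f\<nu>: "(\<Sum>y\<in>T. \<nu> y * (norm (f y))\<^sup>2) \<le> v + (norm m)\<^sup>2 / 4"
    using v(2) unfolding shift[OF mass(2)] m(2) by simp
  \<comment> \<open>Both masses are 1, so the centre \<open>m / 2\<close> drops out of the
    difference.\<close>
  have "(\<Sum>y\<in>T. of_real (\<mu> y - \<nu> y) * f y)
      = (\<Sum>y\<in>T. of_real (\<mu> y) * \<Phi> y - of_real (\<nu> y) * \<Phi> y - of_real (\<mu> y - \<nu> y) * (m / 2))"
    unfolding f_def by (intro sum.cong refl) (simp add: algebra_simps)
  also have "\<dots> = m - 0 - of_real (sum \<mu> T - sum \<nu> T) * (m / 2)"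
    by (simp only: sum_subtractf m sum_distrib_right[symmetric] of_real_sum[symmetric])
  finally have "m = (\<Sum>y\<in>T. of_real (\<mu> y - \<nu> y) * f y)"
    by (simp add: mass)
  then have "norm m \<le> (\<Sum>y\<in>T. norm (of_real (\<mu> y - \<nu> y) * f y))"
    using norm_sum by metis
  also have "\<dots> \<le> (\<Sum>y\<in>T. (sqrt (\<mu> y + \<nu> y) * norm (f y)) * sqrt \<bar>\<mu> y - \<nu> y\<bar>)"
  proof (rule sum_mono)
    fix y assume y: "y \<in> T"
    have "\<bar>\<mu> y - \<nu> y\<bar> = sqrt \<bar>\<mu> y - \<nu> y\<bar> * sqrt \<bar>\<mu> y - \<nu> y\<bar>" by simp
    also have "\<dots> \<le> sqrt (\<mu> y + \<nu> y) * sqrt \<bar>\<mu> y - \<nu> y\<bar>"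
      using nonneg[OF y] by (intro mult_right_mono) auto
    finally have "\<bar>\<mu> y - \<nu> y\<bar> * norm (f y) \<le> sqrt (\<mu> y + \<nu> y) * sqrt \<bar>\<mu> y - \<nu> y\<bar> * norm (f y)"
      by (intro mult_right_mono) auto
    then show "norm (of_real (\<mu> y - \<nu> y) * f y) \<le> (sqrt (\<mu> y + \<nu> y) * norm (f y)) * sqrt \<bar>\<mu> y - \<nu> y\<bar>"
      unfolding norm_mult norm_of_real by (simp only: mult_ac)
  qed
  finally have "(norm m)\<^sup>2 \<le> (\<Sum>y\<in>T. (sqrt (\<mu> y + \<nu> y) * norm (f y)) * sqrt \<bar>\<mu> y - \<nu> y\<bar>)\<^sup>2"
    by (intro power_mono) auto
  also have "\<dots> \<le> (\<Sum>y\<in>T. (sqrt (\<mu> y + \<nu> y) * norm (f y))\<^sup>2) * (\<Sum>y\<in>T. (sqrt \<bar>\<mu> y - \<nu> y\<bar>)\<^sup>2)"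
    by (rule Cauchy_Schwarz_ineq_sum)
  also have "(\<Sum>y\<in>T. (sqrt (\<mu> y + \<nu> y) * norm (f y))\<^sup>2)
      = (\<Sum>y\<in>T. \<mu> y * (norm (f y))\<^sup>2) + (\<Sum>y\<in>T. \<nu> y * (norm (f y))\<^sup>2)"
    unfolding sum.distrib[symmetric] using nonneg
    by (intro sum.cong refl) (simp add: power_mult_distrib distrib_right)
  also have "(\<Sum>y\<in>T. (sqrt \<bar>\<mu> y - \<nu> y\<bar>)\<^sup>2) = (\<Sum>y\<in>T. \<bar>\<mu> y - \<nu> y\<bar>)" by simp
  also have "((\<Sum>y\<in>T. \<mu> y * (norm (f y))\<^sup>2) + (\<Sum>y\<in>T. \<nu> y * (norm (f y))\<^sup>2)) * (\<Sum>y\<in>T. \<bar>\<mu> y - \<nu> y\<bar>)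
      \<le> (2 * v + (norm m)\<^sup>2 / 2) * (\<Sum>y\<in>T. \<bar>\<mu> y - \<nu> y\<bar>)"
    using f\<mu> f\<nu> by (intro mult_right_mono) (auto intro!: sum_nonneg)
  finally show ?thesis .
qed

section \<open>Gaps of the frequencies in the test function\<close>

text \<open>The double sum of cosines of differences is the squared modulus of a sum of unit
  vectors.\<close>

lemma gap_alt:
  "real n * (real n - 1) * gap n q b
   = (real n)\<^sup>2 - (\<Sum>k<n. cos (2 * pi * of_int (b k) / real q))\<^sup>2
      - (\<Sum>k<n. sin (2 * pi * of_int (b k) / real q))\<^sup>2"
proof -
  let ?s = "\<Sum>i<n. \<Sum>j<n. 1 - cos (2 * pi * of_int (b i - b j) / real q)"
  have eq: "1 - cos (2 * pi * of_int (b i - b j) / real q)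
      = 1 - cos (2 * pi * of_int (b i) / real q) * cos (2 * pi * of_int (b j) / real q)
          - sin (2 * pi * of_int (b i) / real q) * sin (2 * pi * of_int (b j) / real q)" for i j
    by (simp add: right_diff_distrib diff_divide_distrib cos_diff)
  have "real n * (real n - 1) * gap n q b = ?s"
  proof (cases "2 \<le> n")
    \<comment> \<open>Division by zero makes \<open>gap\<close> vanish for \<open>n \<le> 1\<close>;
      the double sum is 0 as well, having at most a diagonal term.\<close>
    case False
    then have "n = 0 \<or> n = 1" by linarith
    then show ?thesis by (auto simp: gap_def)
  qed (simp add: gap_def)
  then show ?thesis
    unfolding eq by (simp add: sum_subtractf sum_product power2_eq_square)
qed

definition basis_vec :: "nat \<Rightarrow> nat \<Rightarrow> int" where
  "basis_vec i k = of_bool (k = i)"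

lemma chi_basis_vec: "i < n \<Longrightarrow> chi n q (basis_vec i) x = unit_root q (int (x i))"
  by (simp add: chi_def basis_vec_def of_bool_def if_distrib[of "\<lambda>u. u * _"] cong: if_cong)

lemma chi_diff: "chi n q (\<lambda>k. b k - c k) x = chi n q b x * cnj (chi n q c x)"
  by (simp add: chi_def cnj_unit_root left_diff_distrib sum_subtractf flip: unit_root_add)

lemma gap_basis_vec:
  assumes "i < n"
  shows "real n * (real n - 1) * gap n q (basis_vec i) = 2 * (real n - 1) * (1 - cos (2 * pi / real q))"
    (is "_ = _ * (1 - cos ?\<theta>)")
proof -
  have C: "(\<Sum>k<n. cos (2 * pi * of_int (basis_vec i k) / real q)) = real n - 1 + cos ?\<theta>"
  proof -
    have "cos (2 * pi * of_int (basis_vec i k) / real q) = 1 + (if k = i then cos ?\<theta> - 1 else 0)" for k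
      by (simp add: basis_vec_def)
    then show ?thesis using assms by (simp add: sum.distrib)
  qed
  have S: "(\<Sum>k<n. sin (2 * pi * of_int (basis_vec i k) / real q)) = sin ?\<theta>"
  proof -
    have "sin (2 * pi * of_int (basis_vec i k) / real q) = (if k = i then sin ?\<theta> else 0)" for k
      by (simp add: basis_vec_def)
    then show ?thesis using assms by simp
  qed
  show ?thesis
    unfolding gap_alt C S sin_squared_eq by (simp add: algebra_simps power2_eq_square)
qed

text \<open>These frequencies arise from expanding the squared modulus of the test function; the two
  sines cancel.\<close>

lemma gap_basis_vec_diff:
  assumes "i < n" "j < n" "i \<noteq> j"
  shows "real n * (real n - 1) * gap n q (\<lambda>k. basis_vec i k - basis_vec j k)
       = 4 * (1 - cos (2 * pi / real q)) * (real n - 1 + cos (2 * pi / real q))"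
    (is "_ = _ * (1 - cos ?\<theta>) * _")
proof -
  have C: "(\<Sum>k<n. cos (2 * pi * of_int (basis_vec i k - basis_vec j k) / real q))
      = real n - 2 + 2 * cos ?\<theta>"
  proof -
    have "cos (2 * pi * of_int (basis_vec i k - basis_vec j k) / real q)
       = 1 + (if k = i then cos ?\<theta> - 1 else 0) + (if k = j then cos ?\<theta> - 1 else 0)" for k
      using assms by (simp add: basis_vec_def)
    then show ?thesis using assms by (simp add: sum.distrib)
  qed
  have S: "(\<Sum>k<n. sin (2 * pi * of_int (basis_vec i k - basis_vec j k) / real q)) = 0"
  proof -
    have "sin (2 * pi * of_int (basis_vec i k - basis_vec j k) / real q)
       = (if k = i then sin ?\<theta> else 0) - (if k = j then sin ?\<theta> else 0)" for k
      using assms by (simp add: basis_vec_def)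
    then show ?thesis using assms by (simp add: sum_subtractf)
  qed
  show ?thesis
    unfolding gap_alt C S by (simp add: algebra_simps power2_eq_square)
qed

text \<open>\<open>\<gamma>\<close> is the gap of each character in \<open>\<Phi>\<close>, while the
  off-diagonal terms of its squared modulus have gap \<open>g2 \<ge> 2 * \<gamma>\<close>. Hence the
  second moment exceeds the squared mean by at most the diagonal contribution
  \<open>n\<close>.\<close>

lemma dg_dist_second_moment:
  fixes t :: real
  assumes "4 \<le> q" "4 \<le> n" "0 \<le> t"
  defines "\<gamma> \<equiv> 2 * (1 - cos (2 * pi / real q)) / real n"
  shows "exp (- (2 * t * \<gamma>)) * (real n - 2)\<^sup>2 * (1 - dg_dist n q s t) \<le> 4 * real n * dg_dist n q s t"
proof -
  let ?T = "tables n q s"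
  let ?e = basis_vec
  let ?d = "\<lambda>i j k. ?e i k - ?e j k"
  let ?h = "dg_heat n q s t"
  define x :: "nat \<Rightarrow> nat" where "x = (\<lambda>i. if i = 0 then s mod q else 0)"
  define N where "N = real (card ?T)"
  define \<Phi> where "\<Phi> y = (\<Sum>i<n. chi n q (?e i) y)" for y
  define g2 where "g2 = 4 * (1 - cos (2 * pi / real q)) * (real n - 1 + cos (2 * pi / real q))
      / (real n * (real n - 1))"
  have q: "0 < q" and n: "2 \<le> n" using assms by auto
  have x: "x \<in> ?T" unfolding x_def using assms by (intro tables_nonempty) auto
  have N: "N > 0" unfolding N_def using x by (auto simp: card_gt_0_iff)
  have \<Phi>2: "of_real ((norm (\<Phi> y))\<^sup>2) = (\<Sum>i<n. \<Sum>j<n. chi n q (?d i j) y)" for y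
    unfolding complex_norm_square \<Phi>_def chi_diff by (simp add: sum_product)
  \<comment> \<open>\<open>4 \<le> q\<close> keeps the angle within a quarter turn; the nonnegative
    cosine gives \<open>g2 \<ge> 2 * \<gamma>\<close>.\<close>
  have c: "0 \<le> cos (2 * pi / real q)"
  proof (rule cos_ge_zero)
    have "- (pi / 2) \<le> 0" "0 \<le> 2 * pi / real q" by auto
    then show "- (pi / 2) \<le> 2 * pi / real q" by linarith
  qed (use assms in \<open>auto simp: field_simps\<close>)
  have g2: "2 * \<gamma> \<le> g2"
  proof -
    have "2 * \<gamma> = 4 * (1 - cos (2 * pi / real q)) * (real n - 1) / (real n * (real n - 1))"
      using assms by (simp add: \<gamma>_def)
    also have "\<dots> \<le> g2"
      unfolding g2_def using assms c by (intro divide_right_mono mult_left_mono) auto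
    finally show ?thesis .
  qed
  have gap1: "gap n q (?e i) = \<gamma>" if "i < n" for i
  proof -
    have "(real n - 1) * (real n * gap n q (?e i)) = (real n - 1) * (2 * (1 - cos (2 * pi / real q)))"
      using gap_basis_vec[OF that, of q] by (simp only: mult_ac)
    then have "real n * gap n q (?e i) = 2 * (1 - cos (2 * pi / real q))"
      using assms by simp
    then show ?thesis using assms unfolding \<gamma>_def by (simp add: eq_divide_eq mult.commute)
  qed
  have gap2: "gap n q (?d i j) = g2" if "i < n" "j < n" "i \<noteq> j" for i j
    using gap_basis_vec_diff[OF that, of q] assms by (simp add: g2_def field_simps)
  have gap0: "gap n q (\<lambda>_. 0) = 0"
    using q by (intro gap_const) auto
  have zero1: "(\<Sum>y\<in>?T. chi n q (?e i) y) = 0" if "i < n" for i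
  proof -
    have "\<not> {..<n} \<subseteq> {i}"
      using card_mono[of "{i}" "{..<n}"] assms by auto
    then obtain j where j: "j < n" "j \<noteq> i" by auto
    show ?thesis
      using j that assms by (intro sum_tables_chi_nonconst[OF q that j(1)])
        (auto simp: basis_vec_def cong_def)
  qed
  have zero2: "(\<Sum>y\<in>?T. chi n q (?d i j) y) = 0" if "i < n" "j < n" "i \<noteq> j" for i j
  proof -
    \<comment> \<open>A third index carries the entry 0, which differs modulo \<open>q\<close> from
      the entry 1 at \<open>i\<close>.\<close>
    have "\<not> {..<n} \<subseteq> {i, j}"
      using card_mono[of "{i, j}" "{..<n}"] assms that by auto
    then obtain k where k: "k < n" "k \<noteq> i" "k \<noteq> j" by auto
    show ?thesis
      using k that assms by (intro sum_tables_chi_nonconst[OF q that(1) k(1)])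
        (auto simp: basis_vec_def cong_def)
  qed
  define m where "m = of_real (exp (- (t * \<gamma>))) * \<Phi> x"
  have m1: "(\<Sum>y\<in>?T. of_real (?h x y) * \<Phi> y) = m"
  proof -
    have "(\<Sum>y\<in>?T. of_real (?h x y) * \<Phi> y) = (\<Sum>i<n. \<Sum>y\<in>?T. of_real (?h x y) * chi n q (?e i) y)"
      unfolding \<Phi>_def by (subst sum.swap) (simp add: sum_distrib_left)
    also have "\<dots> = (\<Sum>i<n. of_real (exp (- (t * \<gamma>))) * chi n q (?e i) x)"
      by (intro sum.cong refl) (simp add: dg_heat_chi[OF q n x assms(3)] gap1)
    finally show ?thesis by (simp add: m_def \<Phi>_def sum_distrib_left)
  qed
  have m2: "(\<Sum>y\<in>?T. of_real (1 / N) * \<Phi> y) = 0"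
  proof -
    have "(\<Sum>y\<in>?T. \<Phi> y) = (\<Sum>i<n. \<Sum>y\<in>?T. chi n q (?e i) y)"
      unfolding \<Phi>_def by (rule sum.swap)
    also have "\<dots> = 0" using zero1 by simp
    finally show ?thesis unfolding sum_distrib_left[symmetric] by simp
  qed
  have "norm (\<Phi> x) \<ge> real n - 2"
  proof -
    have "\<Phi> x = (\<Sum>i<n. unit_root q (int (x i)))"
      unfolding \<Phi>_def by (intro sum.cong refl) (simp add: chi_basis_vec)
    also have "\<dots> = (\<Sum>i<n. 1 + (if i = 0 then unit_root q (int (s mod q)) - 1 else 0))"
      by (intro sum.cong refl) (auto simp: x_def)
    also have "\<dots> = of_real (real n - 1) + unit_root q (int (s mod q))"
      using assms by (simp add: sum.distrib)
    finally have eq: "\<Phi> x = of_real (real n - 1) + unit_root q (int (s mod q))" .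
    have "norm (complex_of_real (real n - 1)) - norm (unit_root q (int (s mod q))) \<le> norm (\<Phi> x)"
      unfolding eq by (rule norm_diff_ineq)
    then show ?thesis using assms by (simp del: of_real_diff)
  qed
  then have \<Phi>x: "(real n - 2)\<^sup>2 \<le> (norm (\<Phi> x))\<^sup>2" using assms by (intro power_mono) auto
  \<comment> \<open>The difference of the sides is \<open>(n - 4) * (n - 1)\<close>. Thus
    \<open>(norm (\<Phi> x))\<^sup>2 - n\<close> is nonnegative and its exponential factor may be
    enlarged.\<close>
  have n4: "real n \<le> (real n - 2)\<^sup>2"
  proof -
    have "0 \<le> (real n - 4) * (real n - 1)" using assms by (intro mult_nonneg_nonneg) auto
    then show ?thesis by (simp add: power2_eq_square algebra_simps)
  qed
  have norm_m: "(norm m)\<^sup>2 = exp (- (2 * t * \<gamma>)) * (norm (\<Phi> x))\<^sup>2"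
    by (simp add: m_def norm_mult power_mult_distrib exp_double[symmetric])
  have v1: "(\<Sum>y\<in>?T. ?h x y * (norm (\<Phi> y))\<^sup>2) \<le> real n + (norm m)\<^sup>2"
  proof -
    \<comment> \<open>Diagonal pairs have the zero frequency and expectation 1; the correction term
      gives one formula for all pairs.\<close>
    have summand: "(\<Sum>y\<in>?T. of_real (?h x y) * chi n q (?d i j) y)
        = of_real (exp (- (t * g2))) * chi n q (?d i j) x + (if i = j then 1 - of_real (exp (- (t * g2))) else 0)"
      if "i < n" "j < n" for i j
      using that by (simp add: dg_heat_chi[OF q n x assms(3)] gap2 gap0)
    have "complex_of_real (\<Sum>y\<in>?T. ?h x y * (norm (\<Phi> y))\<^sup>2)
        = (\<Sum>y\<in>?T. \<Sum>i<n. \<Sum>j<n. of_real (?h x y) * chi n q (?d i j) y)"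
      unfolding of_real_sum of_real_mult \<Phi>2 by (simp add: sum_distrib_left)
    also have "\<dots> = (\<Sum>i<n. \<Sum>j<n. \<Sum>y\<in>?T. of_real (?h x y) * chi n q (?d i j) y)"
      by (subst sum.swap, subst (2) sum.swap) simp
    also have "\<dots> = (\<Sum>i<n. \<Sum>j<n. of_real (exp (- (t * g2))) * chi n q (?d i j) x
        + (if i = j then 1 - of_real (exp (- (t * g2))) else 0))"
      using summand by (intro sum.cong refl) simp
    also have "\<dots> = of_real (exp (- (t * g2))) * (\<Sum>i<n. \<Sum>j<n. chi n q (?d i j) x)
        + of_nat n * (1 - of_real (exp (- (t * g2))))"
      by (simp add: sum.distrib sum_distrib_left)
    also have "\<dots> = of_real (real n + exp (- (t * g2)) * ((norm (\<Phi> x))\<^sup>2 - real n))"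
      unfolding \<Phi>2[symmetric] by (simp add: algebra_simps)
    finally have "(\<Sum>y\<in>?T. ?h x y * (norm (\<Phi> y))\<^sup>2) = real n + exp (- (t * g2)) * ((norm (\<Phi> x))\<^sup>2 - real n)"
      using of_real_eq_iff by blast
    also have "\<dots> \<le> real n + exp (- (2 * t * \<gamma>)) * (norm (\<Phi> x))\<^sup>2"
    proof -
      have "exp (- (t * g2)) \<le> exp (- (2 * t * \<gamma>))"
        using mult_left_mono[OF g2 assms(3)] by simp
      then show ?thesis
        using \<Phi>x n4 by (intro add_left_mono mult_mono) auto
    qed
    finally show ?thesis unfolding norm_m .
  qed
  have v2: "(\<Sum>y\<in>?T. (1 / N) * (norm (\<Phi> y))\<^sup>2) \<le> real n"
  proof -
    have summand: "(\<Sum>y\<in>?T. chi n q (?d i j) y) = (if i = j then of_real N else 0)" if "i < n" "j < n" for i j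
      using that zero2 by (simp add: N_def)
    have "complex_of_real (\<Sum>y\<in>?T. (norm (\<Phi> y))\<^sup>2) = (\<Sum>y\<in>?T. \<Sum>i<n. \<Sum>j<n. chi n q (?d i j) y)"
      unfolding of_real_sum \<Phi>2 ..
    also have "\<dots> = (\<Sum>i<n. \<Sum>j<n. \<Sum>y\<in>?T. chi n q (?d i j) y)"
      by (subst sum.swap, subst (2) sum.swap) simp
    also have "\<dots> = (\<Sum>i<n. \<Sum>j<n. if i = j then of_real N else 0)"
      using summand by (intro sum.cong refl) simp
    also have "\<dots> = of_real (real n * N)" by simp
    finally have "(\<Sum>y\<in>?T. (norm (\<Phi> y))\<^sup>2) = real n * N"
      using of_real_eq_iff by blast
    then show ?thesis using N by (simp flip: sum_divide_distrib)
  qed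
  let ?\<delta> = "dg_dist n q s t"
  have "(norm m)\<^sup>2 \<le> (2 * real n + (norm m)\<^sup>2 / 2) * (\<Sum>y\<in>?T. \<bar>?h x y - 1 / N\<bar>)"
  proof (rule l1_distance_ge_second_moment[OF _ _ _ _ m1 m2 v1 v2])
    show "(\<Sum>y\<in>?T. 1 / N) = 1" using x by (auto simp: N_def)
  qed (use N q n x assms(3) in \<open>auto intro: dg_heat_nonneg dg_heat_sum\<close>)
  also have "\<dots> \<le> (2 * real n + (norm m)\<^sup>2 / 2) * (2 * ?\<delta>)"
    using dg_tv_ge_l1[OF q n x assms(3)] dg_tv_le_dist[OF x, of t] unfolding N_def
    by (intro mult_left_mono) auto
  finally have main: "(norm m)\<^sup>2 * (1 - ?\<delta>) \<le> 4 * real n * ?\<delta>" by (simp add: algebra_simps)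
  have \<delta>0: "0 \<le> ?\<delta>"
  proof -
    have "0 \<le> (\<Sum>y\<in>?T. \<bar>?h x y - 1 / card ?T\<bar>)" by (intro sum_nonneg) auto
    then show ?thesis using dg_tv_ge_l1[OF q n x assms(3)] dg_tv_le_dist[OF x, of t] by linarith
  qed
  show ?thesis
  proof (cases "?\<delta> \<le> 1")
    case True
    have "exp (- (2 * t * \<gamma>)) * (real n - 2)\<^sup>2 * (1 - ?\<delta>) \<le> (norm m)\<^sup>2 * (1 - ?\<delta>)"
      unfolding norm_m using True \<Phi>x by (intro mult_right_mono mult_left_mono) auto
    then show ?thesis using main by linarith
  next
    case False
    then have "exp (- (2 * t * \<gamma>)) * (real n - 2)\<^sup>2 * (1 - ?\<delta>) \<le> 0"
      by (intro mult_nonneg_nonpos) auto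
    also have "0 \<le> 4 * real n * ?\<delta>" using \<delta>0 by simp
    finally show ?thesis .
  qed
qed

lemma one_minus_cos_le: "1 - cos x \<le> x\<^sup>2 / 2" for x :: real
proof -
  have "1 - cos x = 2 * (sin (x / 2))\<^sup>2"
    using cos_double_sin[of "x / 2"] by simp
  also have "(sin (x / 2))\<^sup>2 \<le> (x / 2)\<^sup>2"
    using abs_sin_x_le_abs_x[of "x / 2"] by (metis abs_le_square_iff)
  finally show ?thesis by (simp add: power_divide)
qed

text \<open>At a smaller \<open>t\<close> with distance at most \<open>\<epsilon>\<close>,
  \<open>exp (- (2 * t * \<gamma>))\<close> would exceed \<open>1 / ?K\<close>, which the second
  moment inequality forbids.\<close>

lemma dg_mixing_time_ge:
  fixes \<epsilon> :: real
  assumes "0 < \<epsilon>" "\<epsilon> < 1" "4 \<le> q" "15 \<le> n"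
  shows "real n * (real q)\<^sup>2 / (8 * pi\<^sup>2)
      * (ln (real n) + ln (1 - 1 / real n) + ln ((inverse \<epsilon> - 1) / 5)) \<le> dg_tmix n q s \<epsilon>"
    (is "?B \<le> _")
proof -
  let ?K = "(real n - 1) * ((inverse \<epsilon> - 1) / 5)"
  have \<epsilon>: "inverse \<epsilon> - 1 > 0" using assms by (simp add: field_simps)
  have K: "?K > 0" using \<epsilon> assms by simp
  have lnK: "ln (real n) + ln (1 - 1 / real n) + ln ((inverse \<epsilon> - 1) / 5) = ln ?K"
  proof -
    have "ln (real n) + ln (1 - 1 / real n) = ln (real n * (1 - 1 / real n))"
      using assms by (subst ln_mult) auto
    also have "real n * (1 - 1 / real n) = real n - 1" using assms by (simp add: field_simps)
    finally show ?thesis using \<epsilon> assms by (subst ln_mult) auto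
  qed
  have "?B \<le> t" if t: "0 \<le> t" "dg_dist n q s t \<le> \<epsilon>" for t
  proof (rule ccontr)
    assume "\<not> ?B \<le> t"
    then have "t < real n * (real q)\<^sup>2 / (8 * pi\<^sup>2) * ln ?K" unfolding lnK by simp
    then have tK: "t * (8 * pi\<^sup>2 / (real n * (real q)\<^sup>2)) < ln ?K"
      using assms by (simp add: field_simps)
    define \<gamma> where "\<gamma> = 2 * (1 - cos (2 * pi / real q)) / real n"
    have "2 * \<gamma> \<le> 8 * pi\<^sup>2 / (real n * (real q)\<^sup>2)"
    proof -
      have "2 * \<gamma> \<le> 4 * ((2 * pi / real q)\<^sup>2 / 2) / real n"
        unfolding \<gamma>_def using one_minus_cos_le[of "2 * pi / real q"]
        by (auto simp: intro!: divide_right_mono)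
      then show ?thesis by (simp add: power_divide power_mult_distrib field_simps)
    qed
    then have "2 * t * \<gamma> \<le> t * (8 * pi\<^sup>2 / (real n * (real q)\<^sup>2))"
      using mult_left_mono[OF _ t(1)] by fastforce
    with tK have "- ln ?K < - (2 * t * \<gamma>)" by linarith
    then have e: "inverse ?K < exp (- (2 * t * \<gamma>))"
      using K by (metis exp_less_cancel_iff exp_ln exp_minus)
    let ?\<delta> = "dg_dist n q s t"
    have "inverse ?K * ((real n - 2)\<^sup>2 * (1 - \<epsilon>)) < exp (- (2 * t * \<gamma>)) * ((real n - 2)\<^sup>2 * (1 - \<epsilon>))"
      using e assms by (intro mult_strict_right_mono) auto
    also have "\<dots> \<le> exp (- (2 * t * \<gamma>)) * ((real n - 2)\<^sup>2 * (1 - ?\<delta>))"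
      using t by (intro mult_left_mono) auto
    also have "\<dots> \<le> 4 * real n * ?\<delta>"
      using dg_dist_second_moment[of q n t s] assms t unfolding \<gamma>_def by simp
    also have "\<dots> \<le> 4 * real n * \<epsilon>" using t by (intro mult_left_mono) auto
    finally have "(real n - 2)\<^sup>2 * (1 - \<epsilon>) < 4 * real n * \<epsilon> * ?K"
      using K by (simp add: field_simps)
    also have "4 * real n * \<epsilon> * ?K = 4 / 5 * real n * (real n - 1) * (1 - \<epsilon>)"
      using assms by (simp add: field_simps)
    finally have "(real n - 2)\<^sup>2 < 4 / 5 * real n * (real n - 1)"
      using assms by simp
    \<comment> \<open>\<open>5 * (n - 2)\<^sup>2 - 4 * n * (n - 1)\<close> equals
      \<open>(n - 15) * (n - 1) + 5\<close>, the source of the bound 15.\<close>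
    moreover have "0 \<le> (real n - 15) * (real n - 1)"
      using assms by (intro mult_nonneg_nonneg) auto
    ultimately show False
      using assms by (simp add: power2_eq_square algebra_simps)
  qed
  moreover have "\<exists>t. 0 \<le> t \<and> dg_dist n q s t \<le> \<epsilon>"
  proof -
    have "\<forall>\<^sub>F t in at_top. heat_trace n q t < (2 * \<epsilon>)\<^sup>2"
      using assms by (intro order_tendstoD[OF heat_trace_tendsto_0]) auto
    then have "\<forall>\<^sub>F t in at_top. heat_trace n q t < (2 * \<epsilon>)\<^sup>2 \<and> 0 \<le> t"
      using eventually_ge_at_top by (rule eventually_conj)
    then obtain t where t: "heat_trace n q t < (2 * \<epsilon>)\<^sup>2" "0 \<le> t"
      using eventually_happens by fastforce
    have "2 * dg_dist n q s t \<le> sqrt (heat_trace n q t)"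
      using assms t by (intro dg_dist_l2) auto
    also have "\<dots> \<le> 2 * \<epsilon>"
      using t assms by (intro real_le_lsqrt) auto
    finally show ?thesis using t by auto
  qed
  ultimately show ?thesis unfolding dg_tmix_def by (intro cInf_greatest) auto
qed


subsection \<open>The energy of a frequency\<close>

text \<open>Scaled to behave like \<open>k\<^sup>2\<close> for small \<open>k\<close>. The last
  factor is the time correction of the theorem; it lifts the energy at \<open>k = 1\<close> to at
  least 1 once \<open>10 \<le> q\<close>.\<close>

definition cos_energy :: "nat \<Rightarrow> int \<Rightarrow> real" where
  "cos_energy q k = (real q)\<^sup>2 / (2 * pi\<^sup>2) * (1 - cos (2 * pi * of_int k / real q)) / (1 - 1 / (3 * real q))"

lemma cos_energy_0 [simp]: "cos_energy q 0 = 0"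
  by (simp add: cos_energy_def)

lemma cos_energy_minus: "cos_energy q (- k) = cos_energy q k"
  by (simp add: cos_energy_def)

lemma cos_energy_minus_commute: "cos_energy q (k - l) = cos_energy q (l - k)"
  using cos_energy_minus[of q "k - l"] by simp

lemma cos_energy_cong: "0 < q \<Longrightarrow> [k = l] (mod int q) \<Longrightarrow> cos_energy q k = cos_energy q l"
  unfolding cos_energy_def Re_unit_root[symmetric] using unit_root_cong by simp

lemma cos_energy_nonneg: "0 < q \<Longrightarrow> 0 \<le> cos_energy q k"
  unfolding cos_energy_def by (intro divide_nonneg_nonneg mult_nonneg_nonneg) auto

lemma sin_ge_cubic: "y - y ^ 3 / 6 \<le> sin y" if "0 \<le> y" for y :: real
proof -
  have "\<bar>sin y - y\<bar> \<le> y ^ 3 / 6"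
    using Maclaurin_sin_bound[of y 3] that by (simp add: numeral_3_eq_3 sin_coeff_def fact_numeral)
  then show ?thesis by linarith
qed

lemma cos_energy_eq_sin:
  "cos_energy q k = (real q)\<^sup>2 / pi\<^sup>2 * (sin (pi * of_int k / real q))\<^sup>2 / (1 - 1 / (3 * real q))"
  using cos_double_sin[of "pi * of_int k / real q"] by (simp add: cos_energy_def mult.assoc)

text \<open>The cubic Taylor bound for the sine, squared. The linear minorant makes later sums
  geometric; at \<open>m = 1\<close> it is 1, which is sharp for large \<open>q\<close>.\<close>

lemma cos_energy_ge_half:
  assumes "10 \<le> q" "1 \<le> m" "2 * m \<le> q"
  shows "(real m + 2) / 3 \<le> cos_energy q (int m)"
proof -
  define y where "y = pi * real m / real q"
  define D where "D = 1 - 1 / (3 * real q)"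
  have D: "0 < D" "D \<le> 1" using assms by (auto simp: D_def field_simps)
  have y: "0 \<le> y" "y \<le> pi / 2" using assms by (auto simp: y_def field_simps)
  have pi2: "pi\<^sup>2 \<le> 99 / 10"
    using power_mono[OF pi_approx(2), of 2] by (simp add: power2_eq_square)
  have y2: "y\<^sup>2 \<le> pi\<^sup>2 / 4"
    using power_mono[OF y(2) y(1), of 2] by (simp add: power_divide)
  have qy: "(real q)\<^sup>2 / pi\<^sup>2 * y\<^sup>2 = (real m)\<^sup>2"
    using assms by (simp add: y_def power_divide power_mult_distrib)
  have "(y * (1 - y\<^sup>2 / 6))\<^sup>2 \<le> (sin y)\<^sup>2"
  proof (rule power_mono)
    show "y * (1 - y\<^sup>2 / 6) \<le> sin y"
      using sin_ge_cubic[OF y(1)] by (simp add: power3_eq_cube power2_eq_square algebra_simps)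
    show "0 \<le> y * (1 - y\<^sup>2 / 6)" using y y2 pi2 by (intro mult_nonneg_nonneg) auto
  qed
  then have "(real q)\<^sup>2 / pi\<^sup>2 * (y * (1 - y\<^sup>2 / 6))\<^sup>2 \<le> (real q)\<^sup>2 / pi\<^sup>2 * (sin y)\<^sup>2"
    by (intro mult_left_mono) auto
  also have "(real q)\<^sup>2 / pi\<^sup>2 * (y * (1 - y\<^sup>2 / 6))\<^sup>2 = (real m)\<^sup>2 * (1 - y\<^sup>2 / 6)\<^sup>2"
    by (simp add: power_mult_distrib qy[symmetric])
  finally have "(real m)\<^sup>2 * (1 - y\<^sup>2 / 6)\<^sup>2 / D \<le> (real q)\<^sup>2 / pi\<^sup>2 * (sin y)\<^sup>2 / D"
    using D by (intro divide_right_mono) auto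
  then have "(real m)\<^sup>2 * (1 - y\<^sup>2 / 6)\<^sup>2 / D \<le> cos_energy q (int m)"
    by (simp add: cos_energy_eq_sin D_def y_def)
  moreover have "(real m + 2) / 3 \<le> (real m)\<^sup>2 * (1 - y\<^sup>2 / 6)\<^sup>2 / D"
  proof (cases "m = 1")
    case True
    \<comment> \<open>Here the time correction pays for the Taylor loss:
      \<open>y\<^sup>2 = pi\<^sup>2 / q\<^sup>2\<close> is at most \<open>1 / q\<close> because
      \<open>pi\<^sup>2 < 10 \<le> q\<close>.\<close>
    have "D \<le> 1 - y\<^sup>2 / 3"
    proof -
      have "y\<^sup>2 = pi\<^sup>2 / (real q * real q)" using True by (simp add: y_def power_divide power2_eq_square)
      also have "\<dots> \<le> real q / (real q * real q)"
        using pi2 assms by (intro divide_right_mono) auto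
      finally have "y\<^sup>2 \<le> 1 / real q" using assms by simp
      then show ?thesis by (simp add: D_def)
    qed
    also have "\<dots> \<le> (1 - y\<^sup>2 / 6)\<^sup>2" using y(1) by (simp add: power2_eq_square algebra_simps)
    finally show ?thesis using D True by (simp add: field_simps)
  next
    case False
    then have m: "2 \<le> real m" using assms by auto
    have "(real m + 2) / 3 \<le> (real m)\<^sup>2 * (34 / 100)"
    proof -
      \<comment> \<open>The product is \<open>1.02 * m\<^sup>2 - m - 2.08\<close>.\<close>
      have "0 \<le> (real m - 2) * (1.02 * real m + 1.04)" using m by (intro mult_nonneg_nonneg) auto
      then show ?thesis using m by (simp add: power2_eq_square field_simps)
    qed
    also have "\<dots> \<le> (real m)\<^sup>2 * (1 - y\<^sup>2 / 6)\<^sup>2"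
    proof (rule mult_left_mono)
      \<comment> \<open>For \<open>y \<le> pi / 2\<close> the factor
        \<open>1 - y\<^sup>2 / 6\<close> is at least \<open>1 - 9.9 / 24 > 0.587\<close>.\<close>
      have "34 / 100 \<le> (587 / 1000 :: real)\<^sup>2" by (simp add: power2_eq_square)
      also have "\<dots> \<le> (1 - y\<^sup>2 / 6)\<^sup>2" using y2 pi2 by (intro power_mono) auto
      finally show "34 / 100 \<le> (1 - y\<^sup>2 / 6)\<^sup>2" .
    qed auto
    also have "\<dots> \<le> (real m)\<^sup>2 * (1 - y\<^sup>2 / 6)\<^sup>2 / D"
      using D by (simp add: le_divide_eq mult_right_le_one_le)
    finally show ?thesis .
  qed
  ultimately show ?thesis by linarith
qed

lemma cos_energy_ge:
  assumes "10 \<le> q" "1 \<le> m" "m < q"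
  shows "(real (min m (q - m)) + 2) / 3 \<le> cos_energy q (int m)"
proof (cases "2 * m \<le> q")
  case True
  then show ?thesis using cos_energy_ge_half[OF assms(1,2)] by (simp add: min_def)
next
  case False
  have "cos_energy q (int m) = cos_energy q (- int (q - m))"
    using assms by (intro cos_energy_cong) (auto simp: cong_iff_dvd_diff of_nat_diff)
  also have "\<dots> = cos_energy q (int (q - m))" by (rule cos_energy_minus)
  finally have "cos_energy q (int m) = cos_energy q (int (q - m))" .
  moreover have "min m (q - m) = q - m" using False by simp
  ultimately show ?thesis
    using cos_energy_ge_half[of q "q - m"] False assms by (simp del: of_nat_diff)
qed

lemma cos_energy_ge_1:
  assumes "10 \<le> q" "a < q" "b < q" "a \<noteq> b"
  shows "1 \<le> cos_energy q (int a - int b)"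
proof -
  have *: "1 \<le> cos_energy q (int a - int b)" if "b < a" "a < q" for a b
  proof -
    have "1 \<le> (real k + 2) / 3" if "1 \<le> k" for k
      using that by simp
    moreover have "1 \<le> min (a - b) (q - (a - b))" using that by arith
    ultimately have "1 \<le> (real (min (a - b) (q - (a - b))) + 2) / 3" .
    also have "\<dots> \<le> cos_energy q (int (a - b))"
      using assms(1) that by (intro cos_energy_ge) auto
    finally show ?thesis using that by (simp add: of_nat_diff)
  qed
  show ?thesis
    using *[of b a] *[of a b] assms cos_energy_minus_commute[of q "int a" "int b"]
    by (cases a b rule: linorder_cases) auto
qed

text \<open>With \<open>u\<close> the cube root of \<open>v\<close>, the term at \<open>m\<close> is
  at most \<open>u ^ (d + 2)\<close>, where \<open>d\<close> is the cyclic distance from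
  \<open>m\<close> to 0. Both directions give a geometric series of size at most
  \<open>u ^ 3 / (1 - u) \<le> 3 / 2 * v\<close>, as \<open>v \<le> 1 / 27\<close> means
  \<open>u \<le> 1 / 3\<close>.\<close>

lemma sum_powr_cos_energy_Suc:
  assumes "10 \<le> q" "0 < v" "v \<le> 1 / 27"
  shows "(\<Sum>m=1..<q. v powr cos_energy q (int m)) \<le> 3 * v"
proof -
  define u where "u = v powr (1 / 3)"
  have v: "v = u ^ 3" using assms by (simp add: u_def powr_power)
  have u0: "0 < u" using assms by (simp add: u_def)
  have u: "u \<le> 1 / 3"
  proof (rule ccontr)
    assume "\<not> u \<le> 1 / 3"
    then have "(1 / 3) ^ 3 < u ^ 3" by (intro power_strict_mono) auto
    then show False using assms by (simp add: v power_divide)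
  qed
  have geo: "(\<Sum>m=1..<q. u ^ (m + 2)) \<le> 3 / 2 * v"
  proof -
    have "(\<Sum>m=1..<q. u ^ (m + 2)) = (\<Sum>m=1..<q. u ^ 2 * u ^ m)"
      by (simp add: power_add power2_eq_square mult_ac)
    also have "\<dots> = u ^ 3 * (\<Sum>m<q - 1. u ^ m)"
    proof -
      have "(\<Sum>m=1..<q. u ^ 2 * u ^ m) = (\<Sum>m=0..<q - 1. u ^ 2 * u ^ Suc m)"
        by (rule sum.reindex_bij_witness[of _ Suc "\<lambda>m. m - 1"]) auto
      then show ?thesis
        by (simp add: sum_distrib_left lessThan_atLeast0 power3_eq_cube power2_eq_square mult_ac)
    qed
    also have "(\<Sum>m<q - 1. u ^ m) \<le> 3 / 2"
    proof -
      have "(\<Sum>m<q - 1. u ^ m) \<le> (\<Sum>m. u ^ m)"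
        using u u0 by (intro sum_le_suminf summable_geometric) auto
      also have "\<dots> = 1 / (1 - u)" using u u0 by (intro suminf_geometric) auto
      also have "\<dots> \<le> 3 / 2" using u by (simp add: field_simps)
      finally show ?thesis .
    qed
    finally show ?thesis using u0 by (simp add: v mult.commute)
  qed
  have "(\<Sum>m=1..<q. v powr cos_energy q (int m)) \<le> (\<Sum>m=1..<q. u ^ (m + 2) + u ^ (q - m + 2))"
  proof (rule sum_mono)
    fix m assume m: "m \<in> {1..<q}"
    have "v powr cos_energy q (int m) \<le> v powr ((real (min m (q - m)) + 2) / 3)"
      using cos_energy_ge[of q m] assms m by (intro powr_mono') auto
    also have "\<dots> = u powr real (min m (q - m) + 2)"
      unfolding u_def powr_powr by (simp add: add.commute)
    also have "\<dots> = u ^ (min m (q - m) + 2)"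
      using u0 by (rule powr_realpow)
    also have "\<dots> \<le> u ^ (m + 2) + u ^ (q - m + 2)"
      using u0 by (simp add: min_def)
    finally show "v powr cos_energy q (int m) \<le> u ^ (m + 2) + u ^ (q - m + 2)" .
  qed
  also have "\<dots> = 2 * (\<Sum>m=1..<q. u ^ (m + 2))"
  proof -
    have "(\<Sum>m=1..<q. u ^ (q - m + 2)) = (\<Sum>m=1..<q. u ^ (m + 2))"
      by (rule sum.reindex_bij_witness[of _ "\<lambda>m. q - m" "\<lambda>m. q - m"]) auto
    then show ?thesis by (simp add: sum.distrib)
  qed
  finally show ?thesis using geo by linarith
qed

lemma bij_betw_mod_shift:
  fixes q c :: nat
  assumes "0 < q"
  shows "bij_betw (\<lambda>m. (m + c) mod q) {..<q} {..<q}"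
proof -
  have inj: "inj_on (\<lambda>m. (m + c) mod q) {..<q}"
  proof (rule inj_onI)
    fix x y assume xy: "x \<in> {..<q}" "y \<in> {..<q}" "(x + c) mod q = (y + c) mod q"
    then have "[x = y] (mod q)" by (metis cong_add_rcancel_nat cong_def)
    then show "x = y" using xy by (simp add: cong_less_modulus_unique_nat)
  qed
  moreover have "(\<lambda>m. (m + c) mod q) ` {..<q} = {..<q}"
    using assms by (intro endo_inj_surj inj) auto
  ultimately show ?thesis by (simp add: bij_betw_def)
qed

text \<open>A translation modulo \<open>q\<close> moves the excluded value \<open>c\<close> to
  0.\<close>

lemma sum_powr_cos_energy:
  assumes "10 \<le> q" "0 < v" "v \<le> 1 / 27" "c < q"
  shows "(\<Sum>m<q. if m = c then 0 else v powr cos_energy q (int m - int c)) \<le> 3 * v"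
proof -
  let ?g = "\<lambda>m. if m = c then 0 else v powr cos_energy q (int m - int c)"
  have "(\<Sum>m<q. ?g m) = (\<Sum>m<q. ?g ((m + c) mod q))"
    using assms by (intro sum.reindex_bij_betw[symmetric] bij_betw_mod_shift) auto
  also have "\<dots> = (\<Sum>m<q. if m = 0 then 0 else v powr cos_energy q (int m))"
  proof (intro sum.cong refl)
    fix m assume m: "m \<in> {..<q}"
    have "(m + c) mod q = c \<longleftrightarrow> m = 0"
    proof
      assume "(m + c) mod q = c"
      then have "[m + c = 0 + c] (mod q)" using assms by (simp add: cong_def)
      then have "[m = 0] (mod q)" unfolding cong_add_rcancel_nat .
      then show "m = 0" using m by (simp add: cong_def)
    qed (use assms in auto)
    moreover have "cos_energy q (int ((m + c) mod q) - int c) = cos_energy q (int m)"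
      using assms by (intro cos_energy_cong)
        (auto simp: cong_def zmod_int mod_diff_left_eq)
    ultimately show "?g ((m + c) mod q) = (if m = 0 then 0 else v powr cos_energy q (int m))" by simp
  qed
  also have "\<dots> = (\<Sum>m=1..<q. v powr cos_energy q (int m))"
    by (rule sum.mono_neutral_cong_right) auto
  finally show ?thesis using sum_powr_cos_energy_Suc[OF assms(1-3)] by simp
qed

lemma sum_powr_cos_energy_full:
  assumes "10 \<le> q" "0 < v" "v \<le> 1 / 27" "c < q"
  shows "(\<Sum>m<q. v powr cos_energy q (int c - int m)) \<le> 1 + 3 * v"
proof -
  have "(\<Sum>m<q. v powr cos_energy q (int c - int m))
      = (\<Sum>m<q. (if m = c then 0 else v powr cos_energy q (int m - int c)) + (if m = c then 1 else 0))"
    using assms by (intro sum.cong refl) (auto simp: cos_energy_minus_commute[of q "int c"])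
  then show ?thesis using sum_powr_cos_energy[OF assms] assms by (simp add: sum.distrib)
qed

section \<open>The heat trace as a sum of weights\<close>

definition energy :: "nat \<Rightarrow> nat \<Rightarrow> (nat \<Rightarrow> nat) \<Rightarrow> real" where
  "energy n q b = (\<Sum>i<n. \<Sum>j<n. cos_energy q (int (b i) - int (b j)))"

definition weight :: "nat \<Rightarrow> nat \<Rightarrow> real \<Rightarrow> (nat \<Rightarrow> nat) \<Rightarrow> real" where
  "weight n q X b = X powr (- (energy n q b / (2 * (real n - 1))))"

text \<open>In \<open>2 * t * gap\<close> the factor \<open>n\<close> cancels and the remaining
  constants are those of \<open>cos_energy\<close>, so each exponential is exactly a power of
  \<open>X\<close>.\<close>

lemma heat_trace_eq_weight:
  assumes "0 < X" "0 < q" "2 \<le> n"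
  shows "heat_trace n q (real n * (real q)\<^sup>2 * ln X / (8 * pi\<^sup>2) * inverse (1 - 1 / (3 * real q)))
       = (\<Sum>b\<in>nonconst n q. weight n q X b) / real q"
proof -
  let ?t = "real n * (real q)\<^sup>2 * ln X / (8 * pi\<^sup>2) * inverse (1 - 1 / (3 * real q))"
  have "exp (- (2 * ?t * gap n q (int \<circ> b))) = weight n q X b" for b
  proof -
    let ?S = "\<Sum>i<n. \<Sum>j<n. 1 - cos (2 * pi * of_int (int (b i) - int (b j)) / real q)"
    have E: "energy n q b = (real q)\<^sup>2 / (2 * pi\<^sup>2) / (1 - 1 / (3 * real q)) * ?S"
      unfolding energy_def cos_energy_def sum_distrib_left by (simp add: field_simps)
    have G: "gap n q (int \<circ> b) = ?S / (real n * (real n - 1))"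
      by (simp add: gap_def)
    have cancel: "2 * (N * Q * L / (8 * p) * inverse P) * (S / (N * M)) = Q / (2 * p) / P * S / (2 * M) * L"
      if "N \<noteq> 0" for N Q L p P S M :: real
      using that by (simp add: divide_simps)
    have "2 * ?t * gap n q (int \<circ> b) = energy n q b / (2 * (real n - 1)) * ln X"
      unfolding E G by (rule cancel) (use assms in auto)
    then show ?thesis using assms by (simp add: weight_def powr_def)
  qed
  then show ?thesis by (simp add: heat_trace_def)
qed


subsection \<open>Frequencies with a dominant value\<close>

text \<open>\<open>c\<close> is the dominant value; allowing a quarter of exceptions keeps the
  exponent in \<open>tilt\<close> at least 3/4 in absolute value.\<close>

definition near_const :: "nat \<Rightarrow> nat \<Rightarrow> nat \<Rightarrow> (nat \<Rightarrow> nat) set" where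
  "near_const n q c = {b \<in> nonconst n q. 4 * card {i. i < n \<and> b i \<noteq> c} \<le> n}"

lemma finite_near_const [simp]: "finite (near_const n q c)"
  by (simp add: near_const_def)

text \<open>Pairs crossing between \<open>S\<close> and its complement occur in both orders and cost
  the energy against \<open>c\<close>; all other pairs are nonnegative and dropped.\<close>

lemma energy_ge_star:
  fixes b :: "nat \<Rightarrow> nat"
  assumes "0 < q" "S = {i. i < n \<and> b i \<noteq> c}"
  shows "2 * (real n - real (card S)) * (\<Sum>i\<in>S. cos_energy q (int (b i) - int c)) \<le> energy n q b"
proof -
  let ?F = "\<lambda>i. cos_energy q (int (b i) - int c)"
  let ?G = "\<lambda>i j. cos_energy q (int (b i) - int (b j))"
  let ?R = "{..<n} - S"
  have S: "S \<subseteq> {..<n}" "finite S" using assms by auto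
  have cR: "real (card ?R) = real n - real (card S)"
    using S card_mono[of "{..<n}" S] by (simp add: card_Diff_subset of_nat_diff)
  have split: "(\<Sum>i<n. g i) = (\<Sum>i\<in>S. g i) + (\<Sum>i\<in>?R. g i)" for g :: "nat \<Rightarrow> real"
    using S by (metis add.commute finite_lessThan sum.subset_diff)
  have "2 * (real n - real (card S)) * (\<Sum>i\<in>S. ?F i) = (\<Sum>i\<in>S. \<Sum>j\<in>?R. ?F i) + (\<Sum>i\<in>?R. \<Sum>j\<in>S. ?F j)"
    by (simp add: cR flip: sum_distrib_left)
  also have "\<dots> = (\<Sum>i\<in>S. \<Sum>j\<in>?R. ?G i j) + (\<Sum>i\<in>?R. \<Sum>j\<in>S. ?G i j)"
    using assms by (intro arg_cong2[of _ _ _ _ "(+)"] sum.cong refl) (auto intro: cos_energy_minus_commute)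
  also have "\<dots> \<le> (\<Sum>i\<in>S. \<Sum>j<n. ?G i j) + (\<Sum>i\<in>?R. \<Sum>j<n. ?G i j)"
    using assms S by (intro add_mono sum_mono sum_mono2) (auto intro: cos_energy_nonneg)
  also have "\<dots> = energy n q b"
    unfolding energy_def split[of "\<lambda>i. \<Sum>j<n. ?G i j"] ..
  finally show ?thesis .
qed

text \<open>The weight per unit of energy of one exceptional coordinate, which has
  \<open>n - k\<close> partners carrying the dominant value.\<close>

definition tilt :: "nat \<Rightarrow> real \<Rightarrow> nat \<Rightarrow> real" where
  "tilt n X k = X powr (- ((real n - real k) / (real n - 1)))"

lemma weight_le_prod:
  assumes "0 < q" "2 \<le> n" "1 \<le> X" "S = {i. i < n \<and> b i \<noteq> c}"
  shows "weight n q X b \<le> (\<Prod>i\<in>S. tilt n X (card S) powr cos_energy q (int (b i) - int c))"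
proof -
  let ?F = "\<lambda>i. cos_energy q (int (b i) - int c)"
  have fin: "finite S" using assms by auto
  have "(\<Prod>i\<in>S. tilt n X (card S) powr ?F i)
      = X powr (- ((real n - real (card S)) / (real n - 1) * (\<Sum>i\<in>S. ?F i)))"
    using fin assms unfolding tilt_def powr_powr
    by (simp add: powr_sum[symmetric] sum_distrib_left sum_negf)
  moreover have "(real n - real (card S)) / (real n - 1) * (\<Sum>i\<in>S. ?F i) \<le> energy n q b / (2 * (real n - 1))"
  proof -
    have cancel: "a / m * s = 2 * a * s / (2 * m)" for a m s :: real by simp
    show ?thesis
      unfolding cancel using assms by (intro divide_right_mono energy_ge_star) auto
  qed
  ultimately show ?thesis
    unfolding weight_def using assms by (auto intro!: powr_mono)
qed

text \<open>The support condition is encoded by coordinate indicators \<open>?p\<close>, so that the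
  sum over the whole cube factors.\<close>

lemma sum_cube_support:
  fixes h :: "nat \<Rightarrow> real"
  assumes "c < q" "S \<subseteq> {..<n}"
  shows "(\<Sum>b | b \<in> cube n q \<and> {i. i < n \<and> b i \<noteq> c} = S. \<Prod>i\<in>S. h (b i))
       = (\<Sum>m<q. if m = c then 0 else h m) ^ card S"
proof -
  let ?p = "\<lambda>i m. if i \<in> S then (if m = c then 0 else h m) else of_bool (m = c)"
  have fin: "finite S" using assms finite_subset by blast
  have "(\<Sum>b | b \<in> cube n q \<and> {i. i < n \<and> b i \<noteq> c} = S. \<Prod>i\<in>S. h (b i))
      = (\<Sum>b\<in>cube n q. \<Prod>i<n. ?p i (b i))"
  proof (rule sum.mono_neutral_cong_left)
    show "\<forall>b\<in>cube n q - {b. b \<in> cube n q \<and> {i. i < n \<and> b i \<noteq> c} = S}. (\<Prod>i<n. ?p i (b i)) = 0"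
    proof
      fix b assume "b \<in> cube n q - {b. b \<in> cube n q \<and> {i. i < n \<and> b i \<noteq> c} = S}"
      then have "{i. i < n \<and> b i \<noteq> c} \<noteq> S" by auto
      then obtain i where "i < n" "(b i \<noteq> c) \<noteq> (i \<in> S)" using assms by auto
      then have "?p i (b i) = 0" by auto
      then show "(\<Prod>i<n. ?p i (b i)) = 0"
        using \<open>i < n\<close> prod_zero[of "{..<n}" "\<lambda>i. ?p i (b i)"] by blast
    qed
    fix b assume b: "b \<in> {b. b \<in> cube n q \<and> {i. i < n \<and> b i \<noteq> c} = S}"
    have "(\<Prod>i<n. ?p i (b i)) = (\<Prod>i\<in>S. ?p i (b i))"
      using b assms by (intro prod.mono_neutral_right) auto
    also have "\<dots> = (\<Prod>i\<in>S. h (b i))"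
      using b by (intro prod.cong refl) auto
    finally show "(\<Prod>i\<in>S. h (b i)) = (\<Prod>i<n. ?p i (b i))" ..
  qed auto
  also have "\<dots> = (\<Prod>i<n. \<Sum>m<q. ?p i m)"
    by (rule sum_prod_cube)
  also have "\<dots> = (\<Prod>i<n. if i \<in> S then (\<Sum>m<q. if m = c then 0 else h m) else 1)"
    using assms by (intro prod.cong refl) (auto simp: of_bool_def)
  also have "\<dots> = (\<Prod>i\<in>S. \<Sum>m<q. if m = c then 0 else h m)"
    using assms by (intro prod.mono_neutral_cong_right) auto
  finally show ?thesis by simp
qed

text \<open>Frequencies are grouped by support. For a fixed support the coordinates are summed
  independently, each giving at most \<open>3 * tilt\<close>; the binomial counts the
  supports.\<close>

lemma sum_near_const_le:
  assumes "10 \<le> q" "2 \<le> n" "81 \<le> X" "c < q"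
  shows "(\<Sum>b\<in>near_const n q c. weight n q X b)
       \<le> (\<Sum>k=1..n div 4. real (n choose k) * (3 * tilt n X k) ^ k)"
proof -
  let ?supp = "\<lambda>b. {i. i < n \<and> b i \<noteq> c}"
  let ?\<S> = "{S. S \<subseteq> {..<n} \<and> card S \<in> {1..n div 4}}"
  have fin: "finite ?\<S>" by (rule finite_subset[of _ "Pow {..<n}"]) auto
  have sub: "?supp ` near_const n q c \<subseteq> ?\<S>"
  proof (rule image_subsetI)
    fix b assume b: "b \<in> near_const n q c"
    \<comment> \<open>Nonconstancy excludes the empty support, hence the start at
      \<open>k = 1\<close>.\<close>
    have "?supp b \<noteq> {}" using b unfolding near_const_def nonconst_def by force
    then have "1 \<le> card (?supp b)" by (simp add: Suc_le_eq card_gt_0_iff)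
    moreover have "card (?supp b) \<le> n div 4" using b by (auto simp: near_const_def)
    ultimately show "?supp b \<in> ?\<S>"
      by (auto simp only: mem_Collect_eq atLeastAtMost_iff subset_iff lessThan_iff)
  qed
  \<comment> \<open>\<open>81 powr (- (3 / 4)) = 1 / 27\<close> is the range of
    \<open>sum_powr_cos_energy\<close>.\<close>
  have tilt: "0 < tilt n X k" "tilt n X k \<le> 1 / 27" if "k \<in> {1..n div 4}" for k
  proof -
    show "0 < tilt n X k" using assms by (simp add: tilt_def)
    have k: "4 * real k \<le> real n" using that by auto
    have "3 / 4 \<le> (real n - real k) / (real n - 1)"
      using k assms by (simp add: field_simps)
    then have "tilt n X k \<le> X powr (- (3 / 4))"
      unfolding tilt_def using assms by (intro powr_mono) auto
    also have "\<dots> \<le> 81 powr (- (3 / 4))"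
      using assms by (intro powr_mono2') auto
    also have "81 powr (- (3 / 4)) = (3 powr 4) powr (- (3 / 4) :: real)" by simp
    also have "\<dots> = 1 / 27" unfolding powr_powr by (simp add: powr_minus)
    finally show "tilt n X k \<le> 1 / 27" .
  qed
  have "(\<Sum>b\<in>near_const n q c. weight n q X b)
      = (\<Sum>S\<in>?\<S>. \<Sum>b | b \<in> near_const n q c \<and> ?supp b = S. weight n q X b)"
    using sum.group[OF finite_near_const fin sub, of "weight n q X"] by simp
  also have "\<dots> \<le> (\<Sum>S\<in>?\<S>. (3 * tilt n X (card S)) ^ card S)"
  proof (rule sum_mono)
    fix S assume S: "S \<in> ?\<S>"
    let ?h = "\<lambda>m. tilt n X (card S) powr cos_energy q (int m - int c)"
    have "(\<Sum>b | b \<in> near_const n q c \<and> ?supp b = S. weight n q X b)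
        \<le> (\<Sum>b | b \<in> near_const n q c \<and> ?supp b = S. \<Prod>i\<in>S. ?h (b i))"
      using assms by (intro sum_mono) (auto intro!: order_trans[OF weight_le_prod[OF _ _ _ refl]])
    also have "\<dots> \<le> (\<Sum>b | b \<in> cube n q \<and> ?supp b = S. \<Prod>i\<in>S. ?h (b i))"
    proof (rule sum_mono2)
      show "finite {b. b \<in> cube n q \<and> ?supp b = S}"
        by (rule finite_subset[OF _ finite_cube[of n q]]) blast
      show "{b. b \<in> near_const n q c \<and> ?supp b = S} \<subseteq> {b. b \<in> cube n q \<and> ?supp b = S}"
        unfolding near_const_def nonconst_def by blast
    qed (intro prod_nonneg, simp)
    also have "\<dots> = (\<Sum>m<q. if m = c then 0 else ?h m) ^ card S"
      using assms S by (intro sum_cube_support) auto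
    also have "\<dots> \<le> (3 * tilt n X (card S)) ^ card S"
      using assms S tilt by (intro power_mono sum_powr_cos_energy sum_nonneg) auto
    finally show "(\<Sum>b | b \<in> near_const n q c \<and> ?supp b = S. weight n q X b)
        \<le> (3 * tilt n X (card S)) ^ card S" .
  qed
  also have "\<dots> = (\<Sum>k=1..n div 4. \<Sum>S | S \<in> ?\<S> \<and> card S = k. (3 * tilt n X (card S)) ^ card S)"
    using fin by (intro sum.group[symmetric]) auto
  also have "\<dots> = (\<Sum>k=1..n div 4. real (n choose k) * (3 * tilt n X k) ^ k)"
  proof (intro sum.cong refl)
    fix k assume k: "k \<in> {1..n div 4}"
    have "{S. S \<in> ?\<S> \<and> card S = k} = {S. S \<subseteq> {..<n} \<and> card S = k}" using k by auto
    then show "(\<Sum>S | S \<in> ?\<S> \<and> card S = k. (3 * tilt n X (card S)) ^ card S)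
        = real (n choose k) * (3 * tilt n X k) ^ k"
      using n_subsets[of "{..<n}" k] by simp
  qed
  finally show ?thesis .
qed

text \<open>Concavity of \<open>ln\<close>: \<open>k\<close> is the convex combination of 1 and
  \<open>n\<close> with weight \<open>\<theta>\<close> on \<open>n\<close>.\<close>

lemma powr_interpolate_le:
  assumes "2 \<le> n" "1 \<le> k" "k \<le> n"
  shows "real n powr ((real k - 1) / (real n - 1)) \<le> real k"
proof -
  define \<theta> where "\<theta> = (real k - 1) / (real n - 1)"
  have \<theta>: "0 \<le> \<theta>" "\<theta> \<le> 1" using assms by (auto simp: \<theta>_def field_simps)
  have "(1 - \<theta>) * ln 1 + \<theta> * ln (real n) \<le> ln ((1 - \<theta>) *\<^sub>R 1 + \<theta> *\<^sub>R real n)"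
    using assms by (intro concave_onD[OF ln_concave \<theta>]) auto
  moreover have "(1 - \<theta>) *\<^sub>R 1 + \<theta> *\<^sub>R real n = real k"
  proof -
    have "\<theta> * (real n - 1) = real k - 1" using assms by (simp add: \<theta>_def)
    then show ?thesis by (simp add: algebra_simps)
  qed
  ultimately have "\<theta> * ln (real n) \<le> ln (real k)" by simp
  then have "exp (\<theta> * ln (real n)) \<le> exp (ln (real k))" by simp
  then show ?thesis using assms by (simp add: powr_def \<theta>_def)
qed

lemma power_self_le_exp_fact: "real k ^ k \<le> exp (real k) * fact k"
proof -
  have exp: "(\<lambda>m. real k ^ m /\<^sub>R fact m) sums exp (real k)" by (rule exp_converges)
  have "(\<Sum>m\<in>{k}. real k ^ m /\<^sub>R fact m) \<le> (\<Sum>m. real k ^ m /\<^sub>R fact m)"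
    using exp by (intro sum_le_suminf) (auto simp: sums_iff)
  then have "(\<Sum>m\<in>{k}. real k ^ m /\<^sub>R fact m) \<le> exp (real k)"
    using exp by (simp add: sums_iff)
  then show ?thesis by (simp add: field_simps)
qed

text \<open>After \<open>(n choose k) \<le> n ^ k / fact k\<close>, each factor \<open>n\<close>
  joins one \<open>n powr (- \<rho>)\<close> to give at most \<open>k\<close>, and
  \<open>k ^ k / fact k \<le> exp k\<close>.\<close>

lemma binomial_tilt_le:
  assumes "2 \<le> n" "1 \<le> k" "4 * k \<le> n" "1 \<le> \<alpha>"
  shows "real (n choose k) * (3 * tilt n (\<alpha> * real n) k) ^ k \<le> (3 * exp 1 * \<alpha> powr (- (3 / 4))) ^ k"
proof -
  define \<rho> where "\<rho> = (real n - real k) / (real n - 1)"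
  have k: "4 * real k \<le> real n" using assms by linarith
  have \<rho>: "3 / 4 \<le> \<rho>" using k assms by (simp add: \<rho>_def field_simps)
  have tilt: "tilt n (\<alpha> * real n) k = \<alpha> powr (- \<rho>) * real n powr (- \<rho>)"
    using assms by (simp add: tilt_def \<rho>_def powr_mult)
  have binom: "real (n choose k) \<le> real n ^ k / fact k"
  proof -
    have "real ((n choose k) * fact k) \<le> real (n ^ k)"
      using binomial_fact_pow[of n k] of_nat_le_iff by blast
    then show ?thesis by (simp add: le_divide_eq)
  qed
  have "real n * real n powr (- \<rho>) = real n powr (1 - \<rho>)"
    using assms by (simp add: powr_diff powr_minus divide_inverse)
  also have "1 - \<rho> = (real k - 1) / (real n - 1)"
    using assms by (simp add: \<rho>_def field_simps)
  finally have nk: "real n * real n powr (- \<rho>) \<le> real k"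
    using powr_interpolate_le[of n k] assms by simp
  have \<alpha>: "\<alpha> powr (- \<rho>) \<le> \<alpha> powr (- (3 / 4))"
    using assms \<rho> by (intro powr_mono) auto
  have "real (n choose k) * (3 * tilt n (\<alpha> * real n) k) ^ k
      \<le> (real n ^ k / fact k) * (3 * tilt n (\<alpha> * real n) k) ^ k"
    using binom by (intro mult_right_mono) (auto simp: tilt_def)
  also have "\<dots> = (3 * \<alpha> powr (- \<rho>)) ^ k * (real n * real n powr (- \<rho>)) ^ k / fact k"
    by (simp add: tilt power_mult_distrib)
  also have "\<dots> \<le> (3 * \<alpha> powr (- \<rho>)) ^ k * real k ^ k / fact k"
    using nk by (intro divide_right_mono mult_left_mono power_mono) auto
  also have "\<dots> \<le> (3 * \<alpha> powr (- \<rho>)) ^ k * (exp (real k) * fact k) / fact k"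
    using power_self_le_exp_fact[of k] by (intro divide_right_mono mult_left_mono) auto
  also have "\<dots> = (3 * exp 1 * \<alpha> powr (- \<rho>)) ^ k"
    by (simp add: power_mult_distrib exp_of_nat_mult[of k 1, simplified])
  also have "\<dots> \<le> (3 * exp 1 * \<alpha> powr (- (3 / 4))) ^ k"
    using \<alpha> by (intro power_mono mult_left_mono) auto
  finally show ?thesis .
qed


subsection \<open>Spread-out frequencies\<close>

text \<open>The exponent is at least twice \<open>E / (4 * n)\<close>. One copy yields
  \<open>X powr (- (n / 16))\<close>; the other is compared with a single row of the energy matrix,
  in which the coordinates decouple.\<close>

lemma sum_spread_le:
  assumes "10 \<le> q" "2 \<le> n" "27 ^ 4 \<le> X"
  shows "(\<Sum>b\<in>nonconst n q - (\<Union>c<q. near_const n q c). weight n q X b)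
       \<le> real q * (4 * X powr (- (1 / 16))) ^ n"
proof -
  let ?B = "nonconst n q - (\<Union>c<q. near_const n q c)"
  let ?G = "\<lambda>b i j. cos_energy q (int (b i) - int (b j))"
  define v where "v = X powr (- (1 / 4))"
  have X: "1 \<le> X" "0 < X" using assms(3) by auto
  have v: "0 < v" "v \<le> 1 / 27"
  proof -
    show "0 < v" using X by (simp add: v_def)
    have "v \<le> (27 ^ 4) powr (- (1 / 4))"
      unfolding v_def using assms by (intro powr_mono2') auto
    also have "(27 ^ 4) powr (- (1 / 4)) = (27 powr 4) powr (- (1 / 4) :: real)" by simp
    also have "\<dots> = 1 / 27" unfolding powr_powr by (simp add: powr_minus)
    finally show "v \<le> 1 / 27" .
  qed
  have point: "weight n q X b \<le> X powr (- (real n / 16)) * (\<Sum>i<n. \<Prod>j<n. v powr ?G b i j)"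
    if b: "b \<in> ?B" for b
  proof -
    define E where "E = energy n q b"
    have bq: "b i < q" if "i < n" for i using b that by (auto simp: nonconst_def cube_def)
    have "real n * (real n / 4) \<le> E"
    proof -
      \<comment> \<open>As \<open>b i\<close> is not dominant, more than a quarter of the
        coordinates differ from it, each at cost at least 1.\<close>
      have row: "real n / 4 \<le> (\<Sum>j<n. ?G b i j)" if i: "i < n" for i
      proof -
        have "b \<notin> near_const n q (b i)" using b bq[OF i] by auto
        then have "n < 4 * card {j. j < n \<and> b j \<noteq> b i}" using b by (auto simp: near_const_def)
        then have "real n / 4 \<le> real (card {j. j < n \<and> b j \<noteq> b i})" by linarith
        also have "\<dots> = (\<Sum>j\<in>{j. j < n \<and> b j \<noteq> b i}. 1)" by simp
        also have "\<dots> \<le> (\<Sum>j\<in>{j. j < n \<and> b j \<noteq> b i}. ?G b i j)"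
          using assms i bq by (intro sum_mono cos_energy_ge_1) auto
        also have "\<dots> \<le> (\<Sum>j<n. ?G b i j)"
          using assms by (intro sum_mono2) (auto intro: cos_energy_nonneg)
        finally show ?thesis .
      qed
      have "(\<Sum>i<n. real n / 4) \<le> (\<Sum>i<n. \<Sum>j<n. ?G b i j)"
        using row by (intro sum_mono) auto
      then show ?thesis by (simp add: E_def energy_def)
    qed
    moreover have "0 \<le> real n * (real n / 4)" by simp
    ultimately have "0 \<le> E" by (rule order_trans[rotated])
    moreover have "real n / 4 \<le> E / real n"
      using \<open>real n * (real n / 4) \<le> E\<close> assms by (simp add: le_divide_eq mult.commute)
    ultimately have E: "real n / 4 \<le> E / real n" "0 \<le> E" by auto
    have En: "E / real n \<le> E / (real n - 1)"
      using E assms by (intro divide_left_mono) auto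
    have "weight n q X b \<le> X powr (- (real n / 16) + (- (E / (4 * real n))))"
    proof -
      have halve: "E / (2 * (real n - 1)) = E / (real n - 1) / 2" and quarter: "E / (4 * real n) = E / real n / 4"
        by simp_all
      have "- (E / (2 * (real n - 1))) \<le> - (real n / 16) + (- (E / (4 * real n)))"
      proof -
        have "- (A / 2) \<le> - (m / 16) + - (B / 4)" if "m / 4 \<le> B" "B \<le> A" for A B m :: real
          using that by linarith
        then show ?thesis unfolding halve quarter using E(1) En .
      qed
      then show ?thesis
        unfolding weight_def E_def[symmetric] using X by (intro powr_mono) auto
    qed
    also have "\<dots> = X powr (- (real n / 16)) * X powr (- (E / (4 * real n)))"
      by (rule powr_add)
    also have "X powr (- (E / (4 * real n))) \<le> (\<Sum>i<n. \<Prod>j<n. v powr ?G b i j)"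
    proof -
      \<comment> \<open>Some row is at most the average row. It depends on \<open>b\<close>, so the
        bound then sums over all rows.\<close>
      have "\<exists>i<n. (\<Sum>j<n. ?G b i j) \<le> E / real n"
      proof (rule ccontr)
        assume "\<not> ?thesis"
        then have "(\<Sum>i<n. E / real n) < (\<Sum>i<n. \<Sum>j<n. ?G b i j)"
          using assms by (intro sum_strict_mono) (auto simp: lessThan_empty_iff)
        then show False using assms by (simp add: E_def energy_def)
      qed
      then obtain i where i: "i < n" "(\<Sum>j<n. ?G b i j) \<le> E / real n" by blast
      have "X powr (- (E / (4 * real n))) \<le> X powr (\<Sum>j<n. - (1 / 4) * ?G b i j)"
        using i X by (intro powr_mono) (auto simp: sum_negf simp flip: sum_divide_distrib)
      also have "\<dots> = (\<Prod>j<n. v powr ?G b i j)"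
        using X by (simp only: v_def powr_powr powr_sum finite_lessThan)
      also have "\<dots> \<le> (\<Sum>i<n. \<Prod>j<n. v powr ?G b i j)"
        using i by (intro member_le_sum[where f = "\<lambda>i. \<Prod>j<n. v powr ?G b i j"]) (auto intro!: prod_nonneg)
      finally show ?thesis .
    qed
    finally show ?thesis by (simp add: mult_left_mono)
  qed
  \<comment> \<open>Replacing \<open>b i\<close> by a free value \<open>c\<close> costs a factor
    \<open>q\<close> and decouples the coordinates, each of which sums to at most
    \<open>1 + 3 * v \<le> 2\<close>.\<close>
  have star: "(\<Sum>b\<in>cube n q. \<Prod>j<n. v powr ?G b i j) \<le> real q * 2 ^ n" if i: "i < n" for i
  proof -
    have "(\<Sum>b\<in>cube n q. \<Prod>j<n. v powr ?G b i j)
        \<le> (\<Sum>b\<in>cube n q. \<Sum>c<q. \<Prod>j<n. v powr cos_energy q (int c - int (b j)))"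
      using i by (intro sum_mono member_le_sum[where f = "\<lambda>c. \<Prod>j<n. v powr cos_energy q (int c - int (_ j))"])
        (auto intro!: prod_nonneg simp: cube_def)
    also have "\<dots> = (\<Sum>c<q. \<Sum>b\<in>cube n q. \<Prod>j<n. v powr cos_energy q (int c - int (b j)))"
      by (rule sum.swap)
    also have "\<dots> = (\<Sum>c<q. \<Prod>j<n. \<Sum>m<q. v powr cos_energy q (int c - int m))"
      using sum_prod_cube[where f = "\<lambda>_ m. v powr cos_energy q (int _ - int m)"]
      by (intro sum.cong refl) (rule sum_prod_cube)
    also have "\<dots> \<le> (\<Sum>c<q. \<Prod>j<n. 2)"
    proof (intro sum_mono prod_mono conjI)
      fix c j assume "c \<in> {..<q}"
      then show "(\<Sum>m<q. v powr cos_energy q (int c - int m)) \<le> 2"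
        using sum_powr_cos_energy_full[OF assms(1) v, of c] v by auto
    qed (auto intro!: sum_nonneg)
    finally show ?thesis by simp
  qed
  have "(\<Sum>b\<in>?B. weight n q X b)
      \<le> (\<Sum>b\<in>?B. X powr (- (real n / 16)) * (\<Sum>i<n. \<Prod>j<n. v powr ?G b i j))"
    using point by (rule sum_mono)
  also have "\<dots> \<le> (\<Sum>b\<in>cube n q. X powr (- (real n / 16)) * (\<Sum>i<n. \<Prod>j<n. v powr ?G b i j))"
    using nonconst_subset by (intro sum_mono2) (auto intro!: mult_nonneg_nonneg sum_nonneg prod_nonneg)
  also have "\<dots> = X powr (- (real n / 16)) * (\<Sum>i<n. \<Sum>b\<in>cube n q. \<Prod>j<n. v powr ?G b i j)"
    unfolding sum_distrib_left[symmetric] by (subst sum.swap) (rule refl)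
  also have "\<dots> \<le> X powr (- (real n / 16)) * (\<Sum>i<n. real q * 2 ^ n)"
    using star by (intro mult_left_mono sum_mono) auto
  also have "\<dots> = real q * X powr (- (real n / 16)) * (real n * 2 ^ n)" by simp
  also have "\<dots> \<le> real q * X powr (- (real n / 16)) * (2 ^ n * 2 ^ n)"
    using of_nat_mono[OF less_imp_le[OF less_exp[of n]], where 'a = real]
    by (intro mult_left_mono mult_right_mono) auto
  also have "\<dots> = real q * (4 * X powr (- (1 / 16))) ^ n"
  proof -
    have "X powr (- (real n / 16)) = (X powr (- (1 / 16))) ^ n"
      using X by (simp add: powr_power)
    moreover have "(2 ^ n * 2 ^ n :: real) = 4 ^ n" by (simp flip: power_mult_distrib)
    ultimately show ?thesis by (simp add: power_mult_distrib)
  qed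
  finally show ?thesis .
qed


subsection \<open>The upper bound\<close>

text \<open>Each dominant value contributes a geometric series of ratio \<open>r\<close>, and the
  division by \<open>q\<close> cancels the choice of that value. The bound \<open>8 ^ 16\<close>
  makes \<open>4 * X powr (- (1 / 16)) \<le> 1 / 2\<close>.\<close>

lemma heat_trace_le:
  assumes "10 \<le> q" "2 \<le> n" "(5 / 2) ^ 4 \<le> \<alpha>" "8 ^ 16 \<le> \<alpha> * real n"
  shows "heat_trace n q (real n * (real q)\<^sup>2 * ln (\<alpha> * real n) / (8 * pi\<^sup>2) * inverse (1 - 1 / (3 * real q)))
      \<le> 7 / sqrt \<alpha> + (1 / 2) ^ n"
proof -
  define X where "X = \<alpha> * real n"
  define r where "r = 3 * exp 1 * \<alpha> powr (- (3 / 4))"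
  have \<alpha>: "1 \<le> \<alpha>" using assms(3) by (simp add: power4_eq_xxxx)
  have X: "8 ^ 16 \<le> X" using assms unfolding X_def by simp
  define \<beta> where "\<beta> = \<alpha> powr (1 / 4)"
  have \<beta>: "5 / 2 \<le> \<beta>"
  proof -
    have "((5 / 2) ^ 4) powr (1 / 4) \<le> \<beta>" unfolding \<beta>_def using assms by (intro powr_mono2) auto
    moreover have "((5 / 2) ^ 4) powr (1 / 4) = ((5 / 2) powr 4) powr (1 / 4 :: real)"
      by (subst powr_numeral) auto
    ultimately show ?thesis unfolding powr_powr by simp
  qed
  have \<beta>2: "sqrt \<alpha> = \<beta>\<^sup>2" using \<alpha> by (simp add: \<beta>_def powr_power powr_half_sqrt)
  have \<beta>3: "\<alpha> powr (- (3 / 4)) = 1 / \<beta> ^ 3"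
  proof -
    have "\<beta> ^ 3 = \<alpha> powr (3 / 4)" using \<alpha> by (simp add: \<beta>_def powr_power)
    then show ?thesis by (simp only: powr_minus_divide)
  qed
  \<comment> \<open>\<open>816 / 100\<close> is three times the bound 2.72 for
    \<open>exp 1\<close>.\<close>
  have r: "0 \<le> r" "r \<le> 816 / 100 / \<beta> ^ 3"
    using e_less_272 \<beta> unfolding r_def \<beta>3 by (auto simp: field_simps)
  have b3: "15625 / 1000 \<le> \<beta> ^ 3"
    using power_mono[OF \<beta>, of 3] by (simp add: power3_eq_cube)
  then have "816 / 100 / \<beta> ^ 3 \<le> 816 / 100 / (15625 / 1000)"
    using \<beta> by (intro divide_left_mono) auto
  then have r1: "r \<le> 53 / 100" using r by simp
  have "(\<Sum>b\<in>nonconst n q. weight n q X b)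
      \<le> (\<Sum>b\<in>(\<Union>c<q. near_const n q c). weight n q X b)
        + (\<Sum>b\<in>nonconst n q - (\<Union>c<q. near_const n q c). weight n q X b)"
  proof -
    have "(\<Union>c<q. near_const n q c) \<subseteq> nonconst n q" by (auto simp: near_const_def)
    then show ?thesis by (subst sum.subset_diff[of "\<Union>c<q. near_const n q c"]) auto
  qed
  also have "(\<Sum>b\<in>(\<Union>c<q. near_const n q c). weight n q X b)
      \<le> (\<Sum>c<q. \<Sum>b\<in>near_const n q c. weight n q X b)"
  proof -
    have "(\<Sum>b\<in>(\<Union>c<q. near_const n q c). weight n q X b)
        \<le> (\<Sum>(c, b)\<in>Sigma {..<q} (near_const n q). weight n q X b)"
      by (rule sum_le_included[where i = snd]) (force simp: weight_def)+
    then show ?thesis by (simp add: sum.Sigma)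
  qed
  also have "\<dots> \<le> (\<Sum>c<q. r / (1 - r))"
  proof (rule sum_mono)
    fix c assume c: "c \<in> {..<q}"
    have "(\<Sum>b\<in>near_const n q c. weight n q X b)
        \<le> (\<Sum>k=1..n div 4. real (n choose k) * (3 * tilt n X k) ^ k)"
      using assms X c by (intro sum_near_const_le) auto
    also have "\<dots> \<le> (\<Sum>k=1..n div 4. r ^ k)"
      unfolding X_def r_def using assms \<alpha> by (intro sum_mono binomial_tilt_le) auto
    also have "\<dots> = r * (\<Sum>k<n div 4. r ^ k)"
      unfolding sum_distrib_left
      by (rule sum.reindex_bij_witness[of _ Suc "\<lambda>m. m - 1"]) (auto simp flip: power_Suc)
    also have "(\<Sum>k<n div 4. r ^ k) \<le> (\<Sum>k. r ^ k)"
      using r r1 by (intro sum_le_suminf summable_geometric) auto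
    also have "(\<Sum>k. r ^ k) = 1 / (1 - r)" using r r1 by (intro suminf_geometric) auto
    finally show "(\<Sum>b\<in>near_const n q c. weight n q X b) \<le> r / (1 - r)"
      using r by (simp add: mult_left_mono)
  qed
  also have "(\<Sum>b\<in>nonconst n q - (\<Union>c<q. near_const n q c). weight n q X b)
      \<le> real q * (4 * X powr (- (1 / 16))) ^ n"
    using assms X by (intro sum_spread_le) auto
  also have "\<dots> \<le> real q * (1 / 2) ^ n"
  proof (intro mult_left_mono power_mono)
    have "X powr (- (1 / 16)) \<le> (8 ^ 16) powr (- (1 / 16))"
      using X by (intro powr_mono2') auto
    also have "(8 ^ 16) powr (- (1 / 16)) = (8 powr 16) powr (- (1 / 16) :: real)"
      by (subst powr_numeral) auto
    also have "\<dots> = 1 / 8" unfolding powr_powr by (simp add: powr_minus)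
    finally show "4 * X powr (- (1 / 16)) \<le> 1 / 2" by simp
  qed auto
  finally have "(\<Sum>b\<in>nonconst n q. weight n q X b) / real q \<le> r / (1 - r) + (1 / 2) ^ n"
    using assms by (simp add: field_simps)
  also have "r / (1 - r) \<le> 7 / sqrt \<alpha>"
  proof -
    \<comment> \<open>Of the three factors \<open>1 / \<beta>\<close>, one is spent as
      \<open>1 / \<beta> \<le> 2 / 5\<close> to bring \<open>816 / 47\<close> below 7.\<close>
    have "r / (1 - r) \<le> r / (47 / 100)"
      using r r1 by (intro divide_left_mono) auto
    also have "\<dots> \<le> 816 / 47 / \<beta> ^ 3" using r by simp
    also have "\<dots> = 816 / 47 / \<beta> * (1 / \<beta>\<^sup>2)" by (simp add: power3_eq_cube power2_eq_square)
    also have "\<dots> \<le> 7 * (1 / \<beta>\<^sup>2)"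
      using \<beta> by (intro mult_right_mono) (auto simp: field_simps)
    finally show ?thesis unfolding \<beta>2 by simp
  qed
  finally show ?thesis
    using heat_trace_eq_weight[of X q n] assms \<alpha> unfolding X_def by simp
qed

section \<open>The threshold and the final estimates\<close>

text \<open>The set is closed, nonempty and bounded below, so \<open>\<alpha>\<close> itself
  satisfies the defining inequality.\<close>

lemma threshold_mem:
  fixes \<epsilon> C :: real
  assumes "0 < \<epsilon>" "0 < C"
  defines "Z \<equiv> {z. 1 \<le> z \<and> exp (C / sqrt z) - 1 \<le> 4 * \<epsilon>\<^sup>2}"
  shows "Inf Z \<in> Z"
proof (rule closed_contains_Inf)
  have "closed ({1..} \<inter> (\<lambda>z. exp (C / sqrt z) - 1) -` {..4 * \<epsilon>\<^sup>2})"
    by (intro continuous_closed_preimage continuous_intros) auto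
  also have "{1..} \<inter> (\<lambda>z. exp (C / sqrt z) - 1) -` {..4 * \<epsilon>\<^sup>2} = Z" by (auto simp: Z_def)
  finally show "closed Z" .
  show "bdd_below Z" by (rule bdd_belowI[of _ 1]) (auto simp: Z_def)
  define L where "L = ln (1 + 4 * \<epsilon>\<^sup>2)"
  have L: "0 < L" using assms unfolding L_def by (intro ln_gt_zero) auto
  \<comment> \<open>The solution of \<open>C / sqrt z = L\<close>, raised to 1 if necessary.\<close>
  define z where "z = max 1 ((C / L)\<^sup>2)"
  have "C / L \<le> sqrt z"
    using assms L by (intro real_le_rsqrt) (auto simp: z_def)
  moreover have "1 \<le> z" by (simp add: z_def)
  ultimately have "C / sqrt z \<le> L" using L by (simp add: field_simps)
  then have "exp (C / sqrt z) \<le> exp L" by simp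
  also have "exp L = 1 + 4 * \<epsilon>\<^sup>2" using assms by (simp add: L_def add_pos_nonneg)
  finally have "z \<in> Z" using \<open>1 \<le> z\<close> by (simp add: Z_def)
  then show "Z \<noteq> {}" by auto
qed

text \<open>The heat trace is at most \<open>7 / sqrt \<alpha> + (1 / 2) ^ n \<le> C / sqrt \<alpha>
  \<le> exp (C / sqrt \<alpha>) - 1 \<le> 4 * \<epsilon>\<^sup>2\<close>; since
  \<open>C > 7\<close>, the slack eventually absorbs the power of 1/2.\<close>

lemma dg_dist_le_threshold:
  fixes \<epsilon> :: real and q s :: "nat \<Rightarrow> nat"
  assumes "0 < \<epsilon>" "\<epsilon> < 1" "filterlim (\<lambda>n. real (q n) / real n) at_top sequentially"
  defines "\<alpha> \<equiv> Inf {z::real. 1 \<le> z \<and> 4 * \<epsilon>^2 \<ge> exp ((4 + 4 * exp (2 / exp 1)) / sqrt z) - 1}"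
  shows "\<forall>\<^sub>F n in sequentially. dg_dist n (q n) (s n)
      (real n * real (q n)^2 * ln (\<alpha> * real n) / (8 * pi^2) * inverse (1 - 1 / (3 * real (q n)))) \<le> \<epsilon>"
proof -
  define C :: real where "C = 4 + 4 * exp (2 / exp 1)"
  have C: "108 / 10 \<le> C"
  proof -
    have "7 / 10 \<le> 2 / exp (1::real)" using e_less_272 by (simp add: field_simps)
    then have "17 / 10 \<le> exp (2 / exp (1::real))"
      using exp_ge_add_one_self[of "2 / exp 1"] by linarith
    then show ?thesis by (simp add: C_def)
  qed
  have mem: "1 \<le> \<alpha>" "exp (C / sqrt \<alpha>) - 1 \<le> 4 * \<epsilon>\<^sup>2"
    using threshold_mem[of \<epsilon> C] assms C unfolding \<alpha>_def C_def[symmetric] by auto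
  have large: "625 / 100 \<le> sqrt \<alpha>"
  proof (rule ccontr)
    assume "\<not> 625 / 100 \<le> sqrt \<alpha>"
    then have "C / (625 / 100) \<le> C / sqrt \<alpha>" using C mem by (intro divide_left_mono) auto
    \<comment> \<open>\<open>10.8 / 6.25 = 4 * 0.432\<close>. The fourth power of the quadratic
      Taylor bound at 0.432 exceeds 5, whereas \<open>\<epsilon> < 1\<close> puts
      \<open>1 + 4 * \<epsilon>\<^sup>2\<close> below 5.\<close>
    moreover have "4 * (432 / 1000) \<le> C / (625 / 100)" using C by simp
    ultimately have "4 * (432 / 1000) \<le> C / sqrt \<alpha>" by linarith
    then have "exp (4 * (432 / 1000)) \<le> exp (C / sqrt \<alpha>)" by simp
    also have "\<dots> < 5" using mem assms power_strict_mono[of \<epsilon> 1 2] by auto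
    finally have "exp (432 / 1000 :: real) ^ 4 < 5"
      using exp_of_nat_mult[of 4 "432 / 1000 :: real"] by simp
    moreover have "(152 / 100) ^ 4 \<le> exp (432 / 1000 :: real) ^ 4"
      using exp_lower_Taylor_quadratic[of "432 / 1000 :: real"]
      by (intro power_mono) (auto simp: power2_eq_square)
    ultimately show False by (simp add: power4_eq_xxxx)
  qed
  have \<alpha>4: "(5 / 2) ^ 4 \<le> \<alpha>"
    using power_mono[OF large, of 2] mem by (simp add: power4_eq_xxxx power2_eq_square)
  have "\<forall>\<^sub>F n in sequentially. 10 \<le> real (q n) / real n"
    using assms(3) by (simp add: filterlim_at_top)
  moreover have "\<forall>\<^sub>F n in sequentially. nat (8 ^ 16) \<le> n" by (rule eventually_ge_at_top)
  moreover have "\<forall>\<^sub>F n in sequentially. (1 / 2 :: real) ^ n < (C - 7) / sqrt \<alpha>"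
    using C mem by (intro order_tendstoD[OF LIMSEQ_power_zero]) auto
  ultimately show ?thesis
  proof eventually_elim
    case (elim n)
    have n: "8 ^ 16 \<le> real n" using elim(2) by simp
    have "10 * real n \<le> real (q n)" using elim(1) n by (simp add: le_divide_eq)
    then have q: "10 \<le> q n" using n by simp
    let ?t = "real n * real (q n)^2 * ln (\<alpha> * real n) / (8 * pi^2) * inverse (1 - 1 / (3 * real (q n)))"
    have \<alpha>n: "real n \<le> \<alpha> * real n" using mem n by (simp add: mult_right_mono)
    have "1 \<le> real n" using n by simp
    then have "1 \<le> \<alpha> * real n" using \<alpha>n by (rule order_trans)
    then have t: "0 \<le> ?t"
      using q by (intro mult_nonneg_nonneg divide_nonneg_nonneg ln_ge_zero) auto
    have "heat_trace n (q n) ?t \<le> 7 / sqrt \<alpha> + (1 / 2) ^ n"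
      using q n \<alpha>4 order_trans[OF n \<alpha>n] by (intro heat_trace_le) auto
    also have "\<dots> \<le> C / sqrt \<alpha>" using elim(3) by (simp add: diff_divide_distrib)
    also have "\<dots> \<le> exp (C / sqrt \<alpha>) - 1" using exp_ge_add_one_self[of "C / sqrt \<alpha>"] by linarith
    also have "\<dots> \<le> (2 * \<epsilon>)\<^sup>2" using mem by simp
    finally have "sqrt (heat_trace n (q n) ?t) \<le> 2 * \<epsilon>"
      using assms by (simp add: real_le_lsqrt)
    moreover have "2 * dg_dist n (q n) (s n) ?t \<le> sqrt (heat_trace n (q n) ?t)"
      using q n t by (intro dg_dist_l2) auto
    ultimately show ?case by simp
  qed
qed

theorem theorem1:
  fixes \<epsilon> :: real and q :: "nat \<Rightarrow> nat" and s :: "nat \<Rightarrow> nat"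
  assumes "0 < \<epsilon>" and "\<epsilon> < 1" and "\<forall>n. 0 < q n"
  shows "(filterlim (\<lambda>n. real (q n) / real n) at_top sequentially \<longrightarrow>
           (let \<alpha> = Inf {z::real. 1 \<le> z \<and>
                       4 * \<epsilon>^2 \<ge> exp ((4 + 4 * exp (2 / exp 1)) / sqrt z) - 1}
            in \<forall>\<delta>>0. \<forall>\<^sub>F n in sequentially.
                 dg_dist n (q n) (s n)
                   (real n * real (q n)^2 * ln (\<alpha> * real n) / (8 * pi^2)
                      * inverse (1 - 1 / (3 * real (q n)))) \<le> \<epsilon> + \<delta>))
       \<and> (filterlim (\<lambda>n. real (q n) / sqrt (ln (real n))) at_top sequentially \<longrightarrow>
           (\<forall>\<^sub>F n in sequentially.
              dg_tmix n (q n) (s n) \<epsilon> \<ge>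
                real n * real (q n)^2 / (8 * pi^2) *
                  (ln (real n) + ln (1 - 1 / real n) + ln ((inverse \<epsilon> - 1) / 5))))"
proof (intro conjI impI)
  assume "filterlim (\<lambda>n. real (q n) / real n) at_top sequentially"
  from dg_dist_le_threshold[OF assms(1,2) this, of s]
  show "let \<alpha> = Inf {z::real. 1 \<le> z \<and>
                       4 * \<epsilon>^2 \<ge> exp ((4 + 4 * exp (2 / exp 1)) / sqrt z) - 1}
            in \<forall>\<delta>>0. \<forall>\<^sub>F n in sequentially.
                 dg_dist n (q n) (s n)
                   (real n * real (q n)^2 * ln (\<alpha> * real n) / (8 * pi^2)
                      * inverse (1 - 1 / (3 * real (q n)))) \<le> \<epsilon> + \<delta>"
    unfolding Let_def by (auto elim!: eventually_mono)
next
  assume "filterlim (\<lambda>n. real (q n) / sqrt (ln (real n))) at_top sequentially"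
  then have "\<forall>\<^sub>F n in sequentially. 4 \<le> real (q n) / sqrt (ln (real n))"
    by (simp add: filterlim_at_top)
  moreover have "\<forall>\<^sub>F n in sequentially. 15 \<le> n" by (rule eventually_ge_at_top)
  ultimately show "\<forall>\<^sub>F n in sequentially.
              dg_tmix n (q n) (s n) \<epsilon> \<ge>
                real n * real (q n)^2 / (8 * pi^2) *
                  (ln (real n) + ln (1 - 1 / real n) + ln ((inverse \<epsilon> - 1) / 5))"
  proof eventually_elim
    case (elim n)
    \<comment> \<open>From \<open>ln n \<ge> 1\<close> the growth of \<open>q\<close> yields
      \<open>4 \<le> q n\<close>, as the second moment bound requires.\<close>
    have "exp 1 \<le> real n" using elim(2) exp_le by linarith
    then have "1 \<le> sqrt (ln (real n))" using elim(2) by (simp add: ln_ge_iff)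
    moreover from this have "4 * sqrt (ln (real n)) \<le> real (q n)"
      using elim(1) by (simp add: le_divide_eq split: if_splits)
    ultimately have "4 \<le> q n" by linarith
    then show ?case using assms elim(2) by (intro dg_mixing_time_ge) auto
  qed
qed

end
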